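(* Let $(\mathcal F_0,\mathbf a)$ be initial data for the completion problem in $\mathcal H=\mathbb C^d$, and let $\lambda=\lambda(S_{\mathcal F_0})$. Then: (1) The set $\Lambda_{\mathbf a}^{\rm op}(\lambda)$ is compact and convex. (2) $\{\lambda(S_{\mathcal F}) : \mathcal F\in \mathcal C_{\mathbf a}^{\rm op}(\mathcal F_0)\}=\{\nu^\downarrow : \nu\in \Lambda_{\mathbf a}^{\rm op}(\lambda)\}$. (3) If $\mathcal F=(\mathcal F_0,\mathcal G)\in \mathcal C_{\mathbf a}^{\rm op}(\mathcal F_0)$ with $\lambda^\uparrow(S_{\mathcal G})=\mu$, then there exists an orthonormal basis $\{v_i\}_{i=1}^d$ of $\mathbb C^d$ with $S_{\mathcal F_0}v_i=\lambda_i v_i$ for every $1\le i\le d$, such that $$S_{\mathcal G}=\sum_{i=1}^d \mu_i\, v_i\otimes v_i \quad\text{and}\quad S_{\mathcal F}=S_{\mathcal F_0}+S_{\mathcal G}=\sum_{i=1}^d(\lambda_i+\mu_i)\, v_i\otimes v_i .$$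
   Context: For a vector $x\in\mathbb R^m$, $x^\downarrow$ (resp. $x^\uparrow$) is its decreasing (resp. increasing) rearrangement. For a positive semidefinite $d\times d$ matrix $S$, $\lambda(S)\in\mathbb R_{\ge0}^d$ is the vector of eigenvalues (with multiplicity) in decreasing order, and $\lambda^\uparrow(S)$ the same in increasing order. $x\otimes y$ is the operator $z\mapsto\langle z,y\rangle x$. Majorization: $x\prec y$ means $\sum_{i\le j}x_i^\downarrow\le\sum_{i\le j}y_i^\downarrow$ for all $j$ with equality of total sums; if $x,y$ have different lengths the shorter is first padded with zeros. For a finite sequence $\mathcal F=\{f_i\}$ in $\mathbb C^d$, its frame operator is $S_{\mathcal F}=\sum_i f_i\otimes f_i$. Initial data for the completion problem is a pair $(\mathcal F_0,\mathbf a)$ with $\mathcal F_0=\{f_i\}_{i=1}^{n_0}$ a finite sequence in $\mathbb C^d$ and $\mathbf a=(\alpha_i)_{i=1}^k\in\mathbb R_{>0}^k$ such that $d-\operatorname{rk}S_{\mathcal F_0}\le k$; put $n=n_0+k$. $\mathcal C_{\mathbf a}(\mathcal F_0)$ is the set of sequences $\mathcal F=(\mathcal F_0,\mathcal G)=\{f_i\}_{i=1}^n$ whose first $n_0$ vectors are $\mathcal F_0$ and whose remaining vectors $\mathcal G=\{f_i\}_{i=n_0+1}^n$ satisfy $\|f_{n_0+i}\|^2=\alpha_i$ for $1\le i\le k$; then $S_{\mathcal F}=S_{\mathcal F_0}+S_{\mathcal G}$. Define $$\mathcal C_{\mathbf a}^{\rm op}(\mathcal F_0)=\{\mathcal F=(\mathcal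 F_0,\mathcal G)\in\mathcal C_{\mathbf a}(\mathcal F_0):\ \lambda(S_{\mathcal F})=(\lambda(S_{\mathcal F_0})+\lambda^\uparrow(S_{\mathcal G}))^\downarrow\},$$ $\Gamma_d(\mathbf a)=\{\mu\in\mathbb R_{\ge0}^d:\ \mu=\mu^\uparrow,\ \mathbf a\prec\mu\}$, and, for $\lambda\in\mathbb R^d_{\ge0}$, $\Lambda_{\mathbf a}^{\rm op}(\lambda)=\{\lambda^\downarrow+\mu:\ \mu\in\Gamma_d(\mathbf a)\}$. *)

theory Defs
  imports "HOL-Analysis.Analysis" "HOL-Computational_Algebra.Computational_Algebra"
begin

text \<open>
  The coordinates of \<open>\<real>\<^sup>d\<close> and \<open>\<complex>\<^sup>d\<close> are indexed by a finite linearly ordered type \<open>'d\<close> with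
  \<open>d = CARD('d)\<close>; the order makes increasing and decreasing rearrangements meaningful.
  Finite sequences of arbitrary length (frames, norm data) are lists.
\<close>

definition vec_list :: "'a ^ 'd::{finite,linorder} \<Rightarrow> 'a list" where
  "vec_list x = map (\<lambda>i. x $ i) (sorted_list_of_set UNIV)"

text \<open>The index \<open>i\<close> is the \<open>card {j. j < i}\<close>-th one, counting from 0.\<close>

definition list_vec :: "'a list \<Rightarrow> 'a ^ 'd::{finite,linorder}" where
  "list_vec xs = (\<chi> i. xs ! card {j. j < i})"

definition dec_list :: "real list \<Rightarrow> real list" where
  "dec_list xs = rev (sort xs)"

definition dec_vec :: "real ^ 'd::{finite,linorder} \<Rightarrow> real ^ 'd::{finite,linorder}" where
  "dec_vec x = list_vec (dec_list (vec_list x))"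

definition inc_vec :: "real ^ 'd::{finite,linorder} \<Rightarrow> real ^ 'd::{finite,linorder}" where
  "inc_vec x = list_vec (sort (vec_list x))"

definition pad_zeros :: "nat \<Rightarrow> real list \<Rightarrow> real list" where
  "pad_zeros n xs = xs @ replicate (n - length xs) 0"

definition majorized :: "real list \<Rightarrow> real list \<Rightarrow> bool" (infix "\<prec>\<^sub>m" 50) where
  "xs \<prec>\<^sub>m ys \<longleftrightarrow>
     (let n = max (length xs) (length ys);
          xs' = dec_list (pad_zeros n xs);
          ys' = dec_list (pad_zeros n ys)
      in (\<forall>j\<le>n. sum_list (take j xs') \<le> sum_list (take j ys')) \<and> sum_list xs' = sum_list ys')"

text \<open>The inner product of \<open>\<complex>\<^sup>d\<close>, linear in its first argument; the library's \<open>inner\<close> on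
  \<open>complex ^ 'd\<close> is the real one. Its norm is the library norm.\<close>

definition cinner :: "complex ^ 'd \<Rightarrow> complex ^ 'd \<Rightarrow> complex" where
  "cinner x y = (\<Sum>i\<in>UNIV. x $ i * cnj (y $ i))"

lemma cinner_self: "cinner x x = of_real ((norm x)\<^sup>2)"
  by (simp add: cinner_def norm_vec_def L2_set_def sum_nonneg flip: complex_norm_square)

definition onb :: "('d \<Rightarrow> complex ^ 'd) \<Rightarrow> bool" where
  "onb v \<longleftrightarrow> (\<forall>i j. cinner (v i) (v j) = (if i = j then 1 else 0)) \<and> vec.span (range v) = UNIV"

definition rank_one :: "complex ^ 'd \<Rightarrow> complex ^ 'd \<Rightarrow> complex ^ 'd ^ 'd" where
  "rank_one x y = matrix (\<lambda>z. cinner z y *s x)"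

lemma rank_one_mult: "rank_one x y *v z = cinner z y *s x"
proof -
  have "Vector_Spaces.linear (*s) (*s) (\<lambda>z. cinner z y *s x)"
    by unfold_locales
      (auto simp: cinner_def vec_eq_iff algebra_simps sum.distrib sum_distrib_left sum_distrib_right)
  then show ?thesis
    unfolding rank_one_def by (rule matrix_works)
qed

definition charpoly_mat :: "complex ^ 'd ^ 'd \<Rightarrow> complex poly" where
  "charpoly_mat S = det (mat [:0, 1:] - map_matrix (\<lambda>c. [:c:]) S)"

text \<open>Used for positive semidefinite \<open>S\<close> only, where all eigenvalues are real
  and taking real parts is merely a change of type.\<close>

definition eigvals ::
  "complex ^ 'd::{finite,linorder} ^ 'd::{finite,linorder} \<Rightarrow> real ^ 'd::{finite,linorder}" where
  "eigvals S = list_vec (rev (sorted_list_of_multiset (image_mset Re (proots (charpoly_mat S)))))"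

definition eigvals_inc ::
  "complex ^ 'd::{finite,linorder} ^ 'd::{finite,linorder} \<Rightarrow> real ^ 'd::{finite,linorder}" where
  "eigvals_inc S = inc_vec (eigvals S)"

definition frame_op :: "(complex ^ 'd) list \<Rightarrow> complex ^ 'd ^ 'd" where
  "frame_op F = (\<Sum>f\<leftarrow>F. rank_one f f)"

definition initial_data :: "(complex ^ 'd) list \<Rightarrow> real list \<Rightarrow> bool" where
  "initial_data F0 a \<longleftrightarrow> (\<forall>\<alpha>\<in>set a. \<alpha> > 0) \<and> CARD('d) - rank (frame_op F0) \<le> length a"

definition completions :: "real list \<Rightarrow> (complex ^ 'd) list \<Rightarrow> (complex ^ 'd) list set" where
  "completions a F0 =
     {F0 @ G | G. length G = length a \<and> (\<forall>i<length a. (norm (G ! i))\<^sup>2 = a ! i)}"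

definition op_completions ::
  "real list \<Rightarrow> (complex ^ 'd::{finite,linorder}) list \<Rightarrow> (complex ^ 'd::{finite,linorder}) list set" where
  "op_completions a F0 =
     {F0 @ G | G. F0 @ G \<in> completions a F0 \<and>
        eigvals (frame_op (F0 @ G)) =
          dec_vec (eigvals (frame_op F0) + eigvals_inc (frame_op G))}"

definition Gamma_set :: "real list \<Rightarrow> (real ^ 'd::{finite,linorder}) set" where
  "Gamma_set a = {\<mu>. (\<forall>i. 0 \<le> \<mu> $ i) \<and> \<mu> = inc_vec \<mu> \<and> a \<prec>\<^sub>m vec_list \<mu>}"

definition Lambda_op ::
  "real list \<Rightarrow> real ^ 'd::{finite,linorder} \<Rightarrow> (real ^ 'd::{finite,linorder}) set" where
  "Lambda_op a lam = {dec_vec lam + \<mu> | \<mu>. \<mu> \<in> Gamma_set a}"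

end

theory Submission
  imports Defs
begin

text \<open>
  Write \<open>A\<close> for the frame operator of the given frame and \<open>B\<close> for that of the added vectors.

  The set of admissible \<open>\<mu>\<close> is a polytope: on increasing vectors the sum of the \<open>j\<close> largest
  entries is the sum over a fixed set of coordinates, so majorization becomes a system of linear
  inequalities (\<open>Gamma_set_eq\<close>), and the prescribed total keeps it bounded.

  The description of the spectra rests on the Schur--Horn theorem in frame form: a
  list \<open>a\<close> consists of the squared norms of vectors with frame operator \<open>B\<close> iff \<open>a\<close> is majorized by
  the spectrum of \<open>B\<close>. Necessity (\<open>frame_norms_majorized\<close>): in an eigenbasis of \<open>B\<close>, \<open>a\<close> is the image
  of the spectrum under a doubly substochastic matrix. Sufficiency (\<open>frame_with_majorized_norms\<close>):
  scaled basis vectors realise the spectrum itself, and rotating two vectors into each other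
  preserves the frame operator while their squared norms exchange values continuously.
  Aligning the eigenbasis of the added vectors with one of \<open>A\<close>, the spectra being in opposite
  order, yields the required completions.

  The common eigenbasis is the equality case of Lidskii's inequality
  (\<open>lidskii_equality_joint_eigenbasis\<close>). Let \<open>\<lambda>\<close> be the decreasing spectrum of \<open>A\<close> and \<open>\<mu>\<close> the
  increasing spectrum of \<open>B\<close>. If \<open>A + B\<close> has spectrum \<open>\<lambda> + \<mu>\<close> up to order, comparing Frobenius norms
  gives \<open>tr (A B) = \<Sum> \<lambda>\<^sub>i \<mu>\<^sub>i\<close>. Expanding the trace in an eigenbasis \<open>u\<close> of \<open>A\<close> and an eigenbasis \<open>w\<close> of
  \<open>B\<close>, this says that the doubly stochastic matrix \<open>D i j = \<bar>\<langle>u\<^sub>i, w\<^sub>j\<rangle>\<bar>\<^sup>2\<close> attains the minimum in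
  the rearrangement inequality. Linear programming duality then restricts the support of \<open>D\<close>
  (\<open>rearrangement_equality_support\<close>): if \<open>u\<^sub>i\<close> and \<open>w\<^sub>j\<close> are not orthogonal, \<open>(\<lambda>\<^sub>i, \<mu>\<^sub>j)\<close> is one of the
  pairs \<open>(\<lambda>\<^sub>m, \<mu>\<^sub>m)\<close>. These pairs form a chain, \<open>\<mu>\<close> growing as \<open>\<lambda>\<close> falls; this forces \<open>B\<close> to preserve the
  eigenspaces of \<open>A\<close>, so \<open>A\<close> and \<open>B\<close> commute. The eigenvalue pairs of a joint eigenbasis lie on the same
  chain, so that sorting the basis along the chain sorts both spectra at once.
\<close>

no_notation fps_nth (infixl "$" 75)

section \<open>Rearrangements of coordinate vectors\<close>

definition pos_of :: "'d::{finite,linorder} \<Rightarrow> nat" where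
  "pos_of i = card {j. j < i}"

lemma length_vec_list [simp]: "length (vec_list (x :: 'a ^ 'd::{finite,linorder})) = CARD('d)"
  by (simp add: vec_list_def)

lemma pos_of_less: "pos_of (i :: 'd::{finite,linorder}) < CARD('d)"
  unfolding pos_of_def by (rule psubset_card_mono) auto

lemma strict_mono_pos_of: "strict_mono (pos_of :: 'd::{finite,linorder} \<Rightarrow> nat)"
proof (rule strict_monoI)
  fix i j :: 'd
  assume "i < j"
  show "pos_of i < pos_of j"
    unfolding pos_of_def by (rule psubset_card_mono) (use \<open>i < j\<close> in auto)
qed

lemma pos_of_le_iff [simp]: "pos_of i \<le> pos_of j \<longleftrightarrow> i \<le> j"
  by (rule strict_mono_less_eq[OF strict_mono_pos_of])

lemma bij_betw_pos_of: "bij_betw pos_of (UNIV :: 'd::{finite,linorder} set) {..<CARD('d)}"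
proof -
  have inj: "inj (pos_of :: 'd \<Rightarrow> nat)"
    by (rule strict_mono_imp_inj_on[OF strict_mono_pos_of])
  have "pos_of ` (UNIV :: 'd set) = {..<CARD('d)}"
    by (rule card_subset_eq) (auto simp: pos_of_less card_image[OF inj])
  with inj show ?thesis by (simp add: bij_betw_def)
qed

lemma sorted_list_UNIV_nth_pos_of:
  "sorted_list_of_set (UNIV :: 'd::{finite,linorder} set) ! pos_of i = i"
proof -
  define xs where "xs = sorted_list_of_set (UNIV :: 'd set)"
  have xs: "sorted_wrt (<) xs" "set xs = UNIV" "length xs = CARD('d)"
    by (simp_all add: xs_def)
  obtain k where k: "k < length xs" "xs ! k = i"
    using xs(2) by (metis UNIV_I in_set_conv_nth)
  have "{j. j < i} = (!) xs ` {..<k}"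
  proof (intro set_eqI iffI)
    fix j assume "j \<in> {j. j < i}"
    moreover obtain l where l: "l < length xs" "xs ! l = j"
      using xs(2) by (metis UNIV_I in_set_conv_nth)
    ultimately have "l < k"
      using k xs(1) sorted_wrt_nth_less[OF xs(1), of k l]
      by (metis linorder_neqE_nat mem_Collect_eq order_less_asym order_less_irrefl)
    with l show "j \<in> (!) xs ` {..<k}" by auto
  next
    fix j assume "j \<in> (!) xs ` {..<k}"
    then show "j \<in> {j. j < i}" using k sorted_wrt_nth_less[OF xs(1)] by auto
  qed
  moreover have "inj_on ((!) xs) {..<k}"
    using k(1) xs(1) by (auto simp: inj_on_def nth_eq_iff_index_eq strict_sorted_iff)
  ultimately have "pos_of i = k"
    by (simp add: pos_of_def card_image)
  with k show ?thesis by (simp add: xs_def)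
qed

lemma vec_list_nth_pos_of [simp]: "vec_list x ! pos_of i = x $ i"
  using pos_of_less[of i] by (simp add: vec_list_def sorted_list_UNIV_nth_pos_of)

lemma list_vec_nth: "list_vec xs $ i = xs ! pos_of i"
  by (simp add: list_vec_def pos_of_def)

lemma list_vec_vec_list [simp]: "list_vec (vec_list x) = x"
  by (simp add: vec_eq_iff list_vec_nth)

lemma vec_list_list_vec:
  assumes "length xs = CARD('d::{finite,linorder})"
  shows "vec_list (list_vec xs :: ('a, 'd) vec) = xs"
proof (rule nth_equalityI)
  fix k assume "k < length (vec_list (list_vec xs :: ('a, 'd) vec))"
  then have "k \<in> pos_of ` (UNIV :: 'd set)"
    using bij_betw_pos_of[where 'd = 'd] by (simp add: bij_betw_def)
  then show "vec_list (list_vec xs :: ('a, 'd) vec) ! k = xs ! k"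
    by (auto simp: list_vec_nth)
qed (simp add: assms)

lemma mset_vec_list: "mset (vec_list x) = image_mset (($) x) (mset_set UNIV)"
  using mset_set_set[of "sorted_list_of_set (UNIV :: 'b set)"] by (simp add: vec_list_def)

lemma sum_list_map_vec_list: "sum_list (map f (vec_list x)) = (\<Sum>i\<in>UNIV. f (x $ i))"
  by (simp add: vec_list_def o_def sum_list_distinct_conv_sum_set)

lemma sorted_vec_list_iff: "sorted (vec_list x) \<longleftrightarrow> (\<forall>i j. i \<le> j \<longrightarrow> x $ i \<le> x $ j)"
proof
  assume s: "sorted (vec_list x)"
  show "\<forall>i j. i \<le> j \<longrightarrow> x $ i \<le> x $ j"
    using sorted_nth_mono[OF s pos_of_le_iff[THEN iffD2]] pos_of_less by fastforce
next
  assume "\<forall>i j. i \<le> j \<longrightarrow> x $ i \<le> x $ j"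
  then show "sorted (vec_list x)"
    unfolding vec_list_def sorted_map
    by (auto intro!: sorted_wrt_mono_rel[OF _ sorted_sorted_list_of_set[of UNIV]])
qed

lemma sorted_rev_vec_list_iff: "sorted (rev (vec_list x)) \<longleftrightarrow> (\<forall>i j. i \<le> j \<longrightarrow> x $ j \<le> x $ i)"
proof
  assume s: "sorted (rev (vec_list x))"
  show "\<forall>i j. i \<le> j \<longrightarrow> x $ j \<le> x $ i"
    using sorted_rev_nth_mono[OF s pos_of_le_iff[THEN iffD2]] pos_of_less by fastforce
next
  assume "\<forall>i j. i \<le> j \<longrightarrow> x $ j \<le> x $ i"
  then show "sorted (rev (vec_list x))"
    unfolding vec_list_def sorted_wrt_rev sorted_wrt_map
    by (auto intro!: sorted_wrt_mono_rel[OF _ sorted_sorted_list_of_set[of UNIV]])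
qed

lemma length_dec_list [simp]: "length (dec_list xs) = length xs"
  by (simp add: dec_list_def)

lemma mset_dec_list [simp]: "mset (dec_list xs) = mset xs"
  by (simp add: dec_list_def)

lemma sorted_rev_dec_list [simp]: "sorted (rev (dec_list xs))"
  by (simp add: dec_list_def)

lemma dec_list_cong: "mset xs = mset ys \<Longrightarrow> dec_list xs = dec_list ys"
  unfolding dec_list_def by (metis sorted_list_of_multiset_mset)

lemma dec_list_eq: "sorted (rev xs) \<Longrightarrow> dec_list xs = xs"
  unfolding dec_list_def by (metis mset_rev rev_rev_ident sorted_list_of_multiset_mset sorted_sort_id)

lemma vec_list_dec_vec: "vec_list (dec_vec x) = dec_list (vec_list x)"
  by (simp add: dec_vec_def vec_list_list_vec)

lemma vec_list_inc_vec: "vec_list (inc_vec x) = sort (vec_list x)"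
  by (simp add: inc_vec_def vec_list_list_vec)

lemma dec_vec_antimono: "i \<le> j \<Longrightarrow> dec_vec x $ j \<le> dec_vec x $ i"
  using sorted_rev_vec_list_iff[of "dec_vec x"] by (simp add: vec_list_dec_vec)

lemma inc_vec_mono: "i \<le> j \<Longrightarrow> inc_vec x $ i \<le> inc_vec x $ j"
  using sorted_vec_list_iff[of "inc_vec x"] by (simp add: vec_list_inc_vec)

lemma dec_vec_eqI:
  assumes "mset (vec_list x) = mset (vec_list y)" "\<And>i j. i \<le> j \<Longrightarrow> y $ j \<le> y $ i"
  shows "dec_vec x = y"
  using assms dec_list_cong[OF assms(1)] dec_list_eq[of "vec_list y"]
  by (simp add: dec_vec_def sorted_rev_vec_list_iff)

lemma inc_vec_eqI:
  assumes "mset (vec_list x) = mset (vec_list y)" "\<And>i j. i \<le> j \<Longrightarrow> y $ i \<le> y $ j"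
  shows "inc_vec x = y"
proof -
  have "sort (vec_list x) = sort (vec_list y)"
    using assms(1) by (metis sorted_list_of_multiset_mset)
  also have "\<dots> = vec_list y"
    using assms(2) by (intro sorted_sort_id) (simp add: sorted_vec_list_iff)
  finally show ?thesis by (simp add: inc_vec_def)
qed

lemma inc_vec_fixed_iff: "\<mu> = inc_vec \<mu> \<longleftrightarrow> (\<forall>i j. i \<le> j \<longrightarrow> \<mu> $ i \<le> \<mu> $ j)"
  using inc_vec_eqI[of \<mu> \<mu>] inc_vec_mono[of _ _ \<mu>] by metis

lemma inc_vec_dec_vec: "inc_vec (dec_vec x) = inc_vec x"
proof -
  have "sort (dec_list (vec_list x)) = sort (vec_list x)"
    by (metis mset_dec_list sorted_list_of_multiset_mset)
  then show ?thesis by (simp add: inc_vec_def vec_list_dec_vec)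
qed

lemma mset_vec_list_permute:
  assumes "bij \<pi>"
  shows "mset (vec_list (\<chi> i. x $ \<pi> i)) = mset (vec_list x)"
proof -
  have "image_mset \<pi> (mset_set UNIV) = mset_set UNIV"
    using assms by (simp add: bij_def image_mset_mset_set)
  then have "image_mset (\<lambda>i. x $ \<pi> i) (mset_set UNIV) = image_mset (($) x) (mset_set UNIV)"
    by (metis (no_types, lifting) image_mset.compositionality comp_def image_mset_cong)
  moreover have "($) (\<chi> i. x $ \<pi> i) = (\<lambda>i. x $ \<pi> i)"
    by (simp add: fun_eq_iff)
  ultimately show ?thesis by (simp add: mset_vec_list)
qed

text \<open>
  The sorting permutation is needed as a bijection of the index type because it is applied to
  basis vectors and eigenvalues simultaneously.
\<close>

lemma exists_bij_sorting:
  fixes f :: "'d::{finite,linorder} \<Rightarrow> 'b::linorder"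
  shows "\<exists>\<pi> :: 'd \<Rightarrow> 'd. bij \<pi> \<and> (\<forall>i j. i \<le> j \<longrightarrow> f (\<pi> i) \<le> f (\<pi> j))"
proof -
  define xs where "xs = sort_key f (sorted_list_of_set (UNIV :: 'd set))"
  have xs: "distinct xs" "set xs = UNIV" "length xs = CARD('d)" "sorted (map f xs)"
    by (simp_all add: xs_def)
  have "bij_betw ((!) xs) {..<CARD('d)} UNIV"
    using bij_betw_nth[of xs "{..<CARD('d)}" UNIV] xs by simp
  then have "bij ((!) xs \<circ> (pos_of :: 'd \<Rightarrow> nat))"
    by (rule bij_betw_trans[OF bij_betw_pos_of])
  moreover have "f (((!) xs \<circ> pos_of) i) \<le> f (((!) xs \<circ> pos_of) j)" if "i \<le> j" for i j :: 'd
    using sorted_nth_mono[OF xs(4), of "pos_of i" "pos_of j"] that pos_of_less[of i] pos_of_less[of j]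
    by (simp add: xs(3))
  ultimately show ?thesis by blast
qed

lemma exists_permuted_list_map_eq:
  assumes "mset (map f xs) = mset ys"
  shows "\<exists>xs'. mset xs' = mset xs \<and> map f xs' = ys"
  using assms
proof (induction ys arbitrary: xs)
  case (Cons y ys)
  then have "y \<in># mset (map f xs)" by simp
  then obtain x where x: "x \<in> set xs" "f x = y" by auto
  have "mset (map f (remove1 x xs)) = mset ys"
    using Cons.prems x by (simp add: image_mset_Diff)
  with Cons.IH obtain xs' where "mset xs' = mset (remove1 x xs)" "map f xs' = ys" by blast
  with x show ?case by (intro exI[of _ "x # xs'"]) simp
qed simp

section \<open>The Hermitian inner product and orthonormal bases\<close>

lemma cinner_add_left: "cinner (x + y) z = cinner x z + cinner y z"
  by (simp add: cinner_def algebra_simps sum.distrib)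

lemma cinner_add_right: "cinner z (x + y) = cinner z x + cinner z y"
  by (simp add: cinner_def algebra_simps sum.distrib)

lemma cinner_diff_left: "cinner (x - y) z = cinner x z - cinner y z"
  by (simp add: cinner_def algebra_simps sum_subtractf)

lemma cinner_mult_left: "cinner (c *s x) z = c * cinner x z"
  by (simp add: cinner_def algebra_simps sum_distrib_left)

lemma cinner_mult_right: "cinner z (c *s x) = cnj c * cinner z x"
  by (simp add: cinner_def algebra_simps sum_distrib_left)

lemma scaleR_eq_smult: "r *\<^sub>R (x :: complex ^ 'd) = complex_of_real r *s x"
  by (simp add: vec_eq_iff complex_eq_iff)

lemma cinner_scaleR_left: "cinner (r *\<^sub>R x) z = of_real r * cinner x z"
  by (simp add: scaleR_eq_smult cinner_mult_left)

lemma cinner_scaleR_right: "cinner z (r *\<^sub>R x) = of_real r * cinner z x"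
  by (simp add: scaleR_eq_smult cinner_mult_right)

lemma cinner_zero [simp]: "cinner 0 z = 0" "cinner z 0 = 0"
  by (simp_all add: cinner_def)

lemma cinner_commute: "cinner y x = cnj (cinner x y)"
  by (simp add: cinner_def mult.commute)

lemma cinner_sum_left: "cinner (\<Sum>i\<in>A. f i) z = (\<Sum>i\<in>A. cinner (f i) z)"
  by (induction A rule: infinite_finite_induct) (auto simp: cinner_add_left)

lemma cinner_sum_right: "cinner z (\<Sum>i\<in>A. f i) = (\<Sum>i\<in>A. cinner z (f i))"
  by (induction A rule: infinite_finite_induct) (auto simp: cinner_add_right)

lemma Re_cinner: "Re (cinner x y) = x \<bullet> y"
  by (simp add: cinner_def inner_vec_def inner_complex_def)

lemma cinner_self_eq_0_iff [simp]: "cinner x x = 0 \<longleftrightarrow> x = 0"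
  by (simp add: cinner_self)

lemma cinner_mult_cinner_swap: "cinner x y * cinner y x = of_real ((cmod (cinner x y))\<^sup>2)"
  by (metis cinner_commute complex_norm_square)

lemma cmod_cinner_commute: "cmod (cinner y x) = cmod (cinner x y)"
  by (metis cinner_commute complex_mod_cnj)

lemma onb_cinner: "onb v \<Longrightarrow> cinner (v i) (v j) = (if i = j then 1 else 0)"
  by (simp add: onb_def)

lemma subspace_cinner_eq_0: "vec.subspace {x. cinner x q = 0}"
  by (auto simp: vec.subspace_def cinner_add_left cinner_mult_left)

text \<open>
  The difference of \<open>x\<close> and its expansion is orthogonal to the basis, hence to the whole space, hence
  to itself.
\<close>

lemma onb_expansion:
  assumes "onb v"
  shows "x = (\<Sum>i\<in>UNIV. cinner x (v i) *s v i)"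
proof -
  define y where "y = x - (\<Sum>i\<in>UNIV. cinner x (v i) *s v i)"
  have "cinner y (v j) = 0" for j
    by (simp add: y_def cinner_diff_left cinner_sum_left cinner_mult_left onb_cinner[OF assms]
        if_distrib[of "(*) _"] cong: if_cong)
  then have "range v \<subseteq> {x. cinner x y = 0}"
    by (auto simp: cinner_commute[of y])
  then have "vec.span (range v) \<subseteq> {x. cinner x y = 0}"
    by (intro vec.span_minimal subspace_cinner_eq_0)
  then have "y \<in> {x. cinner x y = 0}"
    using assms unfolding onb_def by blast
  then show ?thesis by (simp add: y_def)
qed

lemma onb_parseval:
  assumes "onb v"
  shows "cinner x y = (\<Sum>i\<in>UNIV. cinner x (v i) * cinner (v i) y)"
  by (subst onb_expansion[OF assms, of x]) (simp add: cinner_sum_left cinner_mult_left)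

lemma onb_norm_square:
  assumes "onb v"
  shows "(norm x)\<^sup>2 = (\<Sum>i\<in>UNIV. (cmod (cinner x (v i)))\<^sup>2)"
proof -
  have "complex_of_real ((norm x)\<^sup>2) = of_real (\<Sum>i\<in>UNIV. (cmod (cinner x (v i)))\<^sup>2)"
    using onb_parseval[OF assms, of x x] by (simp add: cinner_self cinner_mult_cinner_swap)
  then show ?thesis using of_real_eq_iff by blast
qed

lemma onb_common_overlap:
  assumes "onb v" "cinner x y \<noteq> 0"
  shows "\<exists>i. cinner x (v i) \<noteq> 0 \<and> cinner (v i) y \<noteq> 0"
proof (rule ccontr)
  assume "\<not> ?thesis"
  then have "cinner x (v i) * cinner (v i) y = 0" for i by auto
  then have "cinner x y = 0" unfolding onb_parseval[OF assms(1), of x y] by (intro sum.neutral) simp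
  with assms(2) show False by simp
qed

lemma onb_norm_1: "onb v \<Longrightarrow> norm (v i) = 1"
proof -
  assume v: "onb v"
  have "(norm (v i))\<^sup>2 = 1"
    using onb_cinner[OF v, of i i] by (metis cinner_self of_real_eq_1_iff)
  then show ?thesis using norm_ge_zero[of "v i"] by (auto simp: power2_eq_1_iff)
qed

lemma onb_eqI:
  assumes "onb v" "\<And>i. cinner x (v i) = cinner y (v i)"
  shows "x = y"
  using onb_expansion[OF assms(1), of x] onb_expansion[OF assms(1), of y] assms(2) by simp

lemma onb_matrix_eqI:
  assumes "onb v" "\<And>i. A *v v i = B *v v i"
  shows "A = B"
proof -
  have "A *v x = B *v x" for x
    by (subst (1 2) onb_expansion[OF assms(1), of x])
      (simp add: vec.sum vec.scale assms(2))
  then show ?thesis by (simp add: matrix_eq)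
qed

lemma onb_permute:
  assumes "onb v" "bij \<pi>"
  shows "onb (\<lambda>i. v (\<pi> i))"
proof -
  have "range (\<lambda>i. v (\<pi> i)) = range v"
    using assms(2) by (metis bij_is_surj fun.set_map image_image)
  with assms show ?thesis by (auto simp: onb_def bij_def inj_eq)
qed

lemma exists_orthogonal_vector:
  assumes "finite Q" "vec.span Q \<noteq> (UNIV :: (complex ^ 'd) set)"
    and "\<And>p q. p \<in> Q \<Longrightarrow> q \<in> Q \<Longrightarrow> cinner p q = (if p = q then 1 else 0)"
  shows "\<exists>x. x \<noteq> 0 \<and> (\<forall>q\<in>Q. cinner x q = 0)"
proof -
  obtain z where z: "z \<notin> vec.span Q" using assms(2) by blast
  define x where "x = z - (\<Sum>q\<in>Q. cinner z q *s q)"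
  have "(\<Sum>q\<in>Q. cinner z q *s q) \<in> vec.span Q"
    by (intro vec.span_sum vec.span_scale vec.span_base)
  with z have "x \<noteq> 0" by (auto simp: x_def)
  moreover have "cinner x p = 0" if "p \<in> Q" for p
  proof -
    have "(\<Sum>q\<in>Q. cinner z q * cinner q p) = (\<Sum>q\<in>Q. if q = p then cinner z p else 0)"
      using assms(3) that by (intro sum.cong) auto
    with that assms(1) show ?thesis
      by (simp add: x_def cinner_diff_left cinner_sum_left cinner_mult_left)
  qed
  ultimately show ?thesis by blast
qed

lemma onb_if_orthonormal:
  fixes v :: "'d::finite \<Rightarrow> complex ^ 'd"
  assumes orth: "\<And>i j. cinner (v i) (v j) = (if i = j then 1 else 0)"
  shows "onb v"
proof -
  have inj: "inj v"
    by (rule injI) (metis orth one_neq_zero)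
  have "vec.independent (range v)"
  proof (rule vec.independent_if_scalars_zero)
    fix f x assume s: "(\<Sum>x\<in>range v. f x *s x) = 0" and "x \<in> range v"
    then obtain i where i: "x = v i" by blast
    have "0 = cinner (\<Sum>x\<in>range v. f x *s x) (v i)" by (simp add: s)
    also have "\<dots> = f x"
      by (simp add: sum.reindex[OF inj] cinner_sum_left cinner_mult_left orth i
          if_distrib[of "(*) _"] cong: if_cong)
    finally show "f x = 0" by simp
  qed simp
  then have "vec.span (range v) = UNIV"
    using vec.card_ge_dim_independent[of "range v" UNIV] by (auto simp: vec_dim_card card_image[OF inj] simp del: vec.dim_UNIV)
  with orth show ?thesis by (simp add: onb_def)
qed

section \<open>Joint diagonalization of commuting Hermitian matrices\<close>

definition hermitian :: "complex ^ 'd ^ 'd \<Rightarrow> bool" where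
  "hermitian A \<longleftrightarrow> (\<forall>x y. cinner (A *v x) y = cinner x (A *v y))"

lemma hermitianD: "hermitian A \<Longrightarrow> cinner (A *v x) y = cinner x (A *v y)"
  by (simp add: hermitian_def)

lemma hermitian_add: "hermitian A \<Longrightarrow> hermitian B \<Longrightarrow> hermitian (A + B)"
  by (simp add: hermitian_def matrix_vector_mult_add_rdistrib cinner_add_left cinner_add_right)

lemma matrix_vector_mult_scaleR: "(A :: complex ^ 'd ^ 'd) *v (r *\<^sub>R x) = r *\<^sub>R (A *v x)"
  by (simp add: scaleR_eq_smult vec.scale)

lemma closed_complex_subspace:
  assumes "vec.subspace (V :: (complex ^ 'd) set)"
  shows "closed V"
proof (rule closed_subspace)
  show "subspace V"
    using assms by (auto simp: subspace_def vec.subspace_def scaleR_eq_smult)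
qed

text \<open>
  Rayleigh's principle: a maximizer \<open>x\<close> of the quadratic form on the unit sphere of \<open>V\<close> is an
  eigenvector. With \<open>m\<close> the maximum, \<open>m - A\<close> is positive semidefinite on \<open>V\<close> and its quadratic form
  vanishes at \<open>x\<close>; a positive semidefinite map annihilates every zero of its form.
\<close>

lemma hermitian_eigenvector_in_subspace:
  fixes A :: "complex ^ 'd ^ 'd"
  assumes A: "hermitian A" and V: "vec.subspace V" and inv: "\<And>x. x \<in> V \<Longrightarrow> A *v x \<in> V"
    and x0: "x0 \<in> V" "x0 \<noteq> 0"
  shows "\<exists>x m. x \<in> V \<and> norm x = 1 \<and> A *v x = m *\<^sub>R x"
proof -
  have VR: "subspace V"
    using V by (auto simp: subspace_def vec.subspace_def scaleR_eq_smult)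
  define K where "K = sphere 0 1 \<inter> V"
  have "compact K"
    unfolding K_def by (intro compact_Int_closed compact_sphere closed_complex_subspace V)
  moreover have "(1 / norm x0) *\<^sub>R x0 \<in> K"
    using x0 VR by (auto simp: K_def subspace_def)
  then have "K \<noteq> {}" by blast
  moreover have "continuous_on K (\<lambda>x. (A *v x) \<bullet> x)"
    by (intro continuous_intros)
  ultimately obtain x where x: "x \<in> K" and max: "\<And>y. y \<in> K \<Longrightarrow> (A *v y) \<bullet> y \<le> (A *v x) \<bullet> x"
    using continuous_attains_sup[of K] by blast
  define m where "m = (A *v x) \<bullet> x"
  define B where "B z = m *\<^sub>R z - A *v z" for z
  have nx: "norm x = 1" and xV: "x \<in> V" using x by (auto simp: K_def)
  have linB: "B (y + r *\<^sub>R z) = B y + r *\<^sub>R B z" for y z r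
    by (simp add: B_def vec.add matrix_vector_mult_scaleR algebra_simps)
  have symB: "B y \<bullet> z = B z \<bullet> y" for y z
  proof -
    have "(A *v y) \<bullet> z = (A *v z) \<bullet> y"
      by (metis A Re_cinner hermitianD inner_commute)
    then show ?thesis by (simp add: B_def inner_diff_left inner_commute[of y z])
  qed
  have pos: "0 \<le> B z \<bullet> z" if "z \<in> V" for z
  proof (cases "z = 0")
    case False
    have "(1 / norm z) *\<^sub>R z \<in> K"
      using False that VR by (auto simp: K_def subspace_def)
    from max[OF this] have "(A *v z) \<bullet> z / (norm z)\<^sup>2 \<le> m"
      by (simp add: matrix_vector_mult_scaleR m_def power2_eq_square)
    then show ?thesis
      using False by (simp add: B_def inner_diff_left power2_norm_eq_inner[symmetric] field_simps)
  qed simp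
  have Bx0: "B x \<bullet> x = 0"
    using nx by (simp add: B_def inner_diff_left m_def power2_norm_eq_inner[symmetric])
  \<comment> \<open>Perturbing \<open>x\<close> in the direction \<open>B x\<close> would make the form negative unless \<open>B x = 0\<close>.\<close>
  define y where "y = B x"
  have yV: "y \<in> V"
    using xV inv[OF xV] VR by (auto simp: y_def B_def subspace_def intro: subspace_diff[OF VR])
  have quad: "0 \<le> 2 * t * (y \<bullet> y) + t\<^sup>2 * (B y \<bullet> y)" for t
  proof -
    have "0 \<le> B (x + t *\<^sub>R y) \<bullet> (x + t *\<^sub>R y)"
      using xV yV VR by (intro pos) (auto simp: subspace_def)
    also have "\<dots> = B x \<bullet> x + t * (B x \<bullet> y) + t * (B y \<bullet> x) + t\<^sup>2 * (B y \<bullet> y)"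
      by (simp add: linB inner_add_left inner_add_right power2_eq_square algebra_simps)
    also have "\<dots> = 2 * t * (y \<bullet> y) + t\<^sup>2 * (B y \<bullet> y)"
      using symB[of y x] by (simp add: Bx0[folded y_def] y_def[symmetric])
    finally show ?thesis .
  qed
  have "y \<bullet> y = 0"
  proof (rule ccontr)
    assume "y \<bullet> y \<noteq> 0"
    then have p: "0 < y \<bullet> y" by simp
    define b where "b = B y \<bullet> y"
    have b: "0 \<le> b" using pos[OF yV] by (simp add: b_def)
    \<comment> \<open>Small and negative enough that the linear term of \<open>quad\<close> outweighs the quadratic one; the summand 1 covers \<open>b = 0\<close>.\<close>
    define t where "t = - (y \<bullet> y) / (b + 1)"
    have "t < 0" using p b by (simp add: t_def divide_neg_pos)
    moreover have "2 * (y \<bullet> y) + t * b > 0"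
    proof -
      have "t * b = - (y \<bullet> y) * (b / (b + 1))" by (simp add: t_def)
      moreover have "b / (b + 1) \<le> 1" using b by simp
      then have "(y \<bullet> y) * (b / (b + 1)) \<le> (y \<bullet> y) * 1" using p by (intro mult_left_mono) auto
      ultimately have "t * b \<ge> - (y \<bullet> y)" by linarith
      with p show ?thesis by linarith
    qed
    ultimately have "t * (2 * (y \<bullet> y) + t * b) < 0" by (simp add: mult_neg_pos)
    with quad[of t] show False by (simp add: b_def power2_eq_square algebra_simps)
  qed
  then have "A *v x = m *\<^sub>R x" by (simp add: y_def B_def)
  with xV nx show ?thesis by blast
qed

text \<open>
  An orthonormal set of joint eigenvectors can be enlarged as long as it does not span: its
  orthogonal complement is invariant under both matrices, and inside it an eigenspace of \<open>A\<close> is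
  invariant under \<open>B\<close>. The case \<open>B = A\<close> is the spectral theorem.
\<close>

lemma commuting_hermitian_joint_eigenbasis:
  fixes A B :: "complex ^ 'd ^ 'd"
  assumes A: "hermitian A" and B: "hermitian B" and AB: "\<And>x. A *v (B *v x) = B *v (A *v x)"
  shows "\<exists>v a b. onb v \<and> (\<forall>i. A *v v i = a i *\<^sub>R v i \<and> B *v v i = b i *\<^sub>R v i)"
proof -
  define J where "J q \<longleftrightarrow> norm q = 1 \<and> (\<exists>\<alpha> \<beta>. A *v q = \<alpha> *\<^sub>R q \<and> B *v q = \<beta> *\<^sub>R q)" for q
  define orth where "orth Q \<longleftrightarrow> finite Q \<and> (\<forall>q\<in>Q. J q) \<and>
      (\<forall>p\<in>Q. \<forall>q\<in>Q. cinner p q = (if p = q then 1 else 0))" for Q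
  have "\<exists>Q. orth Q \<and> card Q = m" if "m \<le> CARD('d)" for m
    using that
  proof (induction m)
    case 0
    then show ?case by (intro exI[of _ "{}"]) (simp add: orth_def)
  next
    case (Suc m)
    then obtain Q where Q: "orth Q" "card Q = m" by auto
    have "vec.span Q \<noteq> UNIV"
    proof
      assume "vec.span Q = UNIV"
      then have "vec.dim (UNIV :: (complex ^ 'd) set) \<le> card Q"
        using Q(1) by (intro vec.dim_le_card) (auto simp: orth_def)
      with Q(2) Suc.prems show False by (simp add: vec_dim_card del: vec.dim_UNIV)
    qed
    then obtain x0 where x0: "x0 \<noteq> 0" "\<forall>q\<in>Q. cinner x0 q = 0"
      using exists_orthogonal_vector[of Q] Q(1) by (auto simp: orth_def)
    define V where "V = {x. \<forall>q\<in>Q. cinner x q = 0}"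
    have V: "vec.subspace V"
      by (auto simp: V_def vec.subspace_def cinner_add_left cinner_mult_left)
    have invA: "A *v x \<in> V" if "x \<in> V" for x
      using that Q(1) by (auto simp: V_def orth_def J_def hermitianD[OF A] cinner_scaleR_right)
    have invB: "B *v x \<in> V" if "x \<in> V" for x
      using that Q(1) by (auto simp: V_def orth_def J_def hermitianD[OF B] cinner_scaleR_right)
    obtain x \<alpha> where x: "x \<in> V" "norm x = 1" "A *v x = \<alpha> *\<^sub>R x"
      using hermitian_eigenvector_in_subspace[OF A V invA, of x0] x0 by (auto simp: V_def)
    define W where "W = V \<inter> {x. A *v x = \<alpha> *\<^sub>R x}"
    have W: "vec.subspace W"
      using V by (auto simp: W_def vec.subspace_def vec.add vec.scale scaleR_eq_smult
          vec.scale_right_distrib mult.commute)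
    have invW: "B *v y \<in> W" if "y \<in> W" for y
      using that invB AB by (auto simp: W_def matrix_vector_mult_scaleR)
    have "x \<in> W" "x \<noteq> 0" using x by (auto simp: W_def)
    then obtain y \<beta> where y: "y \<in> W" "norm y = 1" "B *v y = \<beta> *\<^sub>R y"
      using hermitian_eigenvector_in_subspace[OF B W invW, of x] by blast
    have yQ: "\<forall>q\<in>Q. cinner y q = 0" using y(1) by (simp add: W_def V_def)
    then have Qy: "\<forall>q\<in>Q. cinner q y = 0" by (metis cinner_commute complex_cnj_zero)
    have yy: "cinner y y = 1" using y(2) by (simp add: cinner_self)
    have "y \<notin> Q" using yQ yy by force
    have "J y" using y by (auto simp: W_def J_def)
    then have "orth (insert y Q)"
      using Q(1) yQ Qy yy \<open>y \<notin> Q\<close> by (auto simp: orth_def)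
    moreover have "card (insert y Q) = Suc m"
      using Q \<open>y \<notin> Q\<close> by (simp add: orth_def)
    ultimately show ?case by blast
  qed
  then obtain Q where Q: "orth Q" "card Q = CARD('d)" by blast
  then obtain v where v: "bij_betw v (UNIV :: 'd set) Q"
    using finite_same_card_bij[of "UNIV :: 'd set" Q] by (auto simp: orth_def)
  have "onb v"
    using v Q(1) by (intro onb_if_orthonormal) (auto simp: orth_def bij_betw_def inj_eq)
  moreover have "J (v i)" for i
    using v Q(1) by (auto simp: orth_def bij_betw_def)
  then have "\<forall>i. \<exists>\<alpha> \<beta>. A *v v i = \<alpha> *\<^sub>R v i \<and> B *v v i = \<beta> *\<^sub>R v i"
    by (simp add: J_def)
  then obtain a b where "\<forall>i. A *v v i = a i *\<^sub>R v i \<and> B *v v i = b i *\<^sub>R v i" by metis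
  ultimately show ?thesis by blast
qed

section \<open>Eigenvalue vectors\<close>

text \<open>
  Conjugation by the unitary matrix of eigenvectors turns the characteristic matrix into a
  diagonal one. The conjugation is carried out over the polynomial ring, where \<open>C\<close> embeds the
  constants.
\<close>

lemma charpoly_mat_diagonalizable:
  fixes S :: "complex ^ 'd ^ 'd"
  assumes v: "onb v" and S: "\<And>i. S *v v i = c i *\<^sub>R v i"
  shows "charpoly_mat S = (\<Prod>i\<in>UNIV. [:- complex_of_real (c i), 1:])"
proof -
  define V :: "complex ^ 'd ^ 'd" where "V = (\<chi> i j. v j $ i)"
  define W :: "complex ^ 'd ^ 'd" where "W = (\<chi> i j. cnj (v i $ j))"
  define C :: "complex \<Rightarrow> complex poly" where "C = (\<lambda>c. [:c:])"
  have C_add: "C (a + b) = C a + C b" and C_0: "C 0 = 0" for a b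
    by (simp_all add: C_def)
  have C_sum: "C (sum f A) = (\<Sum>i\<in>A. C (f i))" for f :: "'d \<Rightarrow> complex" and A
    by (induction A rule: infinite_finite_induct) (auto simp: C_add C_0)
  have C_mult: "C (a * b) = C a * C b" for a b
    by (simp add: C_def)
  have map_mult: "map_matrix C (X ** Y) = map_matrix C X ** map_matrix C Y"
    for X Y :: "complex ^ 'd ^ 'd"
    by (simp add: vec_eq_iff map_matrix_def matrix_matrix_mult_def C_sum C_mult)
  have WV: "W ** V = mat 1"
  proof -
    have "(W ** V) $ i $ j = cinner (v j) (v i)" for i j
      by (simp add: W_def V_def matrix_matrix_mult_def cinner_def mult.commute)
    then show ?thesis by (simp add: vec_eq_iff mat_def onb_cinner[OF v])
  qed
  have WSV: "W ** S ** V = (\<chi> i j. if i = j then complex_of_real (c i) else 0)"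
  proof -
    have SV: "(S ** V) $ k $ j = (S *v v j) $ k" for k j
      by (simp add: V_def matrix_matrix_mult_def matrix_vector_mult_def)
    have "(W ** (S ** V)) $ i $ j = cinner (S *v v j) (v i)" for i j
    proof -
      have "(W ** (S ** V)) $ i $ j = (\<Sum>k\<in>UNIV. W $ i $ k * (S ** V) $ k $ j)"
        by (simp add: matrix_matrix_mult_def)
      then show ?thesis
        unfolding SV by (simp add: W_def cinner_def mult.commute)
    qed
    then show ?thesis
      by (auto simp: vec_eq_iff matrix_mul_assoc[symmetric] S cinner_scaleR_left onb_cinner[OF v])
  qed
  let ?X = "mat [:0, 1:] :: complex poly ^ 'd ^ 'd"
  let ?V = "map_matrix C V" and ?W = "map_matrix C W"
  have WV': "?W ** ?V = mat 1"
    unfolding map_mult[symmetric] WV by (simp add: vec_eq_iff map_matrix_def mat_def C_def one_pCons)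
  have "?W ** (?X - map_matrix C S) ** ?V = ?W ** ?X ** ?V - ?W ** map_matrix C S ** ?V"
    by (simp add: vec_eq_iff matrix_matrix_mult_def algebra_simps sum_subtractf)
  also have "?W ** ?X = ?X ** ?W"
    by (simp add: vec_eq_iff matrix_matrix_mult_def mat_def if_distrib[of "(*) _"]
        if_distrib[of "\<lambda>x. x * _"] cong: if_cong)
  also have "?X ** ?W ** ?V = ?X ** (?W ** ?V)"
    by (simp add: matrix_mul_assoc)
  also have "\<dots> = ?X" by (simp add: WV')
  also have "?W ** map_matrix C S ** ?V = map_matrix C (\<chi> i j. if i = j then complex_of_real (c i) else 0)"
    by (simp only: map_mult[symmetric] WSV)
  finally have eq: "?W ** (?X - map_matrix C S) ** ?V =
      ?X - map_matrix C (\<chi> i j. if i = j then complex_of_real (c i) else 0)" .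
  have "det ?W * det ?V = 1"
    by (simp add: det_mul[symmetric] WV')
  then have "charpoly_mat S = det ?W * det ?V * det (?X - map_matrix C S)"
    by (simp add: charpoly_mat_def C_def)
  also have "\<dots> = det (?W ** (?X - map_matrix C S) ** ?V)"
    by (simp only: det_mul mult_ac)
  also have "\<dots> = det (?X - map_matrix C (\<chi> i j. if i = j then complex_of_real (c i) else 0))"
    by (simp only: eq)
  also have "\<dots> = (\<Prod>i\<in>UNIV. [:- complex_of_real (c i), 1:])"
    by (subst det_diagonal) (auto simp: mat_def map_matrix_def C_def)
  finally show ?thesis .
qed

text \<open>
  The characteristic polynomial does not depend on the eigenbasis, so any eigenbasis computes the
  eigenvalue vector; all later statements on spectra go through this lemma.
\<close>

lemma eigvals_eq:
  fixes S :: "complex ^ 'd::{finite,linorder} ^ 'd::{finite,linorder}"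
  assumes v: "onb v" and S: "\<And>i. S *v v i = (c $ i) *\<^sub>R v i"
  shows "eigvals S = dec_vec c"
proof -
  have "proots (charpoly_mat S) = (\<Sum>i\<in>UNIV. {#complex_of_real (c $ i)#})"
    by (simp add: charpoly_mat_diagonalizable[OF v S] proots_prod)
  also have "\<dots> = image_mset (\<lambda>i. complex_of_real (c $ i)) (mset_set UNIV)"
    by (simp add: sum_unfold_sum_mset)
  finally have "image_mset Re (proots (charpoly_mat S)) = mset (vec_list c)"
    by (simp add: mset_vec_list image_mset.compositionality comp_def)
  then show ?thesis
    by (simp add: eigvals_def dec_vec_def dec_list_def)
qed

section \<open>Frame operators\<close>

lemma rank_one_nth: "rank_one x y $ i $ j = x $ i * cnj (y $ j)"
  by (simp add: rank_one_def matrix_def cinner_def axis_def if_distrib[of "\<lambda>x. x * _"] cong: if_cong)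

lemma rank_one_scaleR: "rank_one (r *\<^sub>R x) (r *\<^sub>R x) = (r * r) *\<^sub>R rank_one x x"
proof -
  have "cnj (r *\<^sub>R z) = r *\<^sub>R cnj z" for z by (simp add: complex_eq_iff)
  then show ?thesis by (simp add: vec_eq_iff rank_one_nth)
qed

lemma frame_op_Nil [simp]: "frame_op [] = 0"
  by (simp add: frame_op_def)

lemma frame_op_Cons [simp]: "frame_op (f # F) = rank_one f f + frame_op F"
  by (simp add: frame_op_def)

lemma frame_op_append [simp]: "frame_op (F @ G) = frame_op F + frame_op G"
  by (simp add: frame_op_def)

lemma frame_op_mset_cong: "mset F = mset G \<Longrightarrow> frame_op F = frame_op G"
  by (simp add: frame_op_def flip: sum_mset_sum_list)

lemma frame_op_replicate_zero [simp]: "frame_op (replicate n 0) = 0"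
  by (induction n) (simp_all add: vec_eq_iff rank_one_nth)

lemma cinner_frame_op: "cinner (frame_op F *v x) y = (\<Sum>f\<leftarrow>F. cinner x f * cinner f y)"
  by (induction F)
    (simp_all add: matrix_vector_mult_add_rdistrib cinner_add_left rank_one_mult cinner_mult_left)

lemma hermitian_frame_op: "hermitian (frame_op F)"
  unfolding hermitian_def
proof (intro allI)
  fix x y
  have "cinner x (frame_op F *v y) = cnj (\<Sum>f\<leftarrow>F. cinner y f * cinner f x)"
    by (subst cinner_commute) (simp add: cinner_frame_op)
  also have "\<dots> = (\<Sum>f\<leftarrow>F. cinner x f * cinner f y)"
  proof (induction F)
    case (Cons f F)
    then show ?case
      using cinner_commute[of y f] cinner_commute[of f x] by (simp add: mult.commute)
  qed simp
  finally show "cinner (frame_op F *v x) y = cinner x (frame_op F *v y)"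
    by (simp add: cinner_frame_op)
qed

lemma cinner_frame_op_self:
  "cinner (frame_op F *v x) x = of_real (\<Sum>f\<leftarrow>F. (cmod (cinner f x))\<^sup>2)"
  by (simp add: cinner_frame_op) (induction F, simp_all add: cinner_mult_cinner_swap cmod_cinner_commute)

lemma matrix_vector_mult_sum:
  fixes M :: "'i \<Rightarrow> complex ^ 'd ^ 'd"
  shows "(\<Sum>i\<in>A. M i) *v x = (\<Sum>i\<in>A. M i *v x)"
  by (induction A rule: infinite_finite_induct) (simp_all add: matrix_vector_mult_add_rdistrib)

lemma spectral_sum_mult:
  assumes "onb v"
  shows "(\<Sum>i\<in>UNIV. c i *\<^sub>R rank_one (v i) (v i)) *v v j = c j *\<^sub>R v j"
proof -
  have "(\<Sum>i\<in>UNIV. c i *\<^sub>R rank_one (v i) (v i)) *v v j = (\<Sum>i\<in>UNIV. (c i *\<^sub>R rank_one (v i) (v i)) *v v j)"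
    by (simp add: matrix_vector_mult_sum)
  also have "\<dots> = (\<Sum>i\<in>UNIV. c i *\<^sub>R (rank_one (v i) (v i) *v v j))"
    by (intro sum.cong refl) (simp add: vec_eq_iff matrix_vector_mult_def scaleR_sum_right)
  also have "\<dots> = (\<Sum>i\<in>UNIV. if i = j then c j *\<^sub>R v j else 0)"
    by (intro sum.cong refl) (simp add: rank_one_mult onb_cinner[OF assms])
  finally show ?thesis by simp
qed

lemma spectral_sum_eq:
  assumes "onb v" "\<And>i. S *v v i = c i *\<^sub>R v i"
  shows "S = (\<Sum>i\<in>UNIV. c i *\<^sub>R rank_one (v i) (v i))"
  by (rule onb_matrix_eqI[OF assms(1)]) (simp add: assms(2) spectral_sum_mult[OF assms(1)])

section \<open>Eigenbases with sorted eigenvalues\<close>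

lemma hermitian_eigenbasis:
  fixes A :: "complex ^ 'd::{finite,linorder} ^ 'd::{finite,linorder}"
  assumes "hermitian A"
  shows "\<exists>v. onb v \<and> (\<forall>i. A *v v i = (eigvals A $ i) *\<^sub>R v i)"
proof -
  obtain v a where v: "onb v" "\<And>i. A *v v i = a i *\<^sub>R v i"
    using commuting_hermitian_joint_eigenbasis[OF assms assms] by blast
  obtain \<pi> :: "'d \<Rightarrow> 'd" where \<pi>: "bij \<pi>" "\<And>i j. i \<le> j \<Longrightarrow> - a (\<pi> i) \<le> - a (\<pi> j)"
    using exists_bij_sorting[of "\<lambda>i. - a i"] by blast
  have e: "A *v v (\<pi> i) = ((\<chi> i. a (\<pi> i)) $ i) *\<^sub>R v (\<pi> i)" for i
    by (simp add: v(2))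
  have "eigvals A = dec_vec (\<chi> i. a (\<pi> i))"
    by (rule eigvals_eq[OF onb_permute[OF v(1) \<pi>(1)] e])
  also have "\<dots> = (\<chi> i. a (\<pi> i))"
    using \<pi>(2) by (intro dec_vec_eqI) auto
  finally show ?thesis
    using onb_permute[OF v(1) \<pi>(1)] e by (intro exI[of _ "\<lambda>i. v (\<pi> i)"]) simp
qed

lemma dec_vec_eigvals: "hermitian A \<Longrightarrow> dec_vec (eigvals A) = eigvals A"
  using hermitian_eigenbasis[of A] eigvals_eq[of _ A "eigvals A"] by metis

lemma hermitian_eigenbasis_inc:
  fixes A :: "complex ^ 'd::{finite,linorder} ^ 'd::{finite,linorder}"
  assumes "hermitian A"
  shows "\<exists>v. onb v \<and> (\<forall>i. A *v v i = (eigvals_inc A $ i) *\<^sub>R v i)"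
proof -
  obtain v where v: "onb v" "\<And>i. A *v v i = (eigvals A $ i) *\<^sub>R v i"
    using hermitian_eigenbasis[OF assms] by blast
  obtain \<pi> :: "'d \<Rightarrow> 'd" where \<pi>: "bij \<pi>" "\<And>i j. i \<le> j \<Longrightarrow> eigvals A $ (\<pi> i) \<le> eigvals A $ (\<pi> j)"
    using exists_bij_sorting[of "\<lambda>i. eigvals A $ i"] by blast
  have "eigvals_inc A = (\<chi> i. eigvals A $ \<pi> i)"
    unfolding eigvals_inc_def using \<pi> by (intro inc_vec_eqI) (auto simp: mset_vec_list_permute)
  then show ?thesis
    using onb_permute[OF v(1) \<pi>(1)] v(2) by (intro exI[of _ "\<lambda>i. v (\<pi> i)"]) simp
qed

section \<open>Squared norms of frames with a given frame operator\<close>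

text \<open>
  The squared norms of the frame vectors arise from the eigenvalues \<open>\<mu>\<close> through the weights
  \<open>\<bar>\<langle>f, v\<^sub>i\<rangle>\<bar>\<^sup>2 / \<mu>\<^sub>i\<close>. Over the frame vectors they add up to 1 for each \<open>i\<close> with \<open>\<mu>\<^sub>i \<noteq> 0\<close>, since
  \<open>\<mu>\<^sub>i = \<langle>S v\<^sub>i, v\<^sub>i\<rangle>\<close>. For the sum \<open>t\<close> over \<open>i\<close> let \<open>h\<close> be a preimage of \<open>f\<close> under the frame operator \<open>S\<close>:
  then \<open>\<langle>f, h\<rangle> = t\<close>, while \<open>t = \<langle>S h, h\<rangle>\<close> is a sum of squares containing \<open>\<bar>\<langle>f, h\<rangle>\<bar>\<^sup>2 = t\<^sup>2\<close>.
  Division by zero makes the weights of the zero eigenvalues vanish.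
\<close>

lemma frame_norms_substochastic:
  fixes F :: "(complex ^ 'd::finite) list"
  assumes v: "onb v" and S: "\<And>i. frame_op F *v v i = \<mu> i *\<^sub>R v i"
  shows "\<mu> i \<ge> 0" "\<mu> i = (\<Sum>f\<leftarrow>F. (cmod (cinner f (v i)))\<^sup>2)"
    and "f \<in> set F \<Longrightarrow> \<mu> i = 0 \<Longrightarrow> cinner f (v i) = 0"
    and "f \<in> set F \<Longrightarrow> (\<Sum>i\<in>UNIV. (cmod (cinner f (v i)))\<^sup>2 / \<mu> i) \<le> 1"
proof -
  show eq: "\<mu> i = (\<Sum>f\<leftarrow>F. (cmod (cinner f (v i)))\<^sup>2)" for i
  proof -
    have "complex_of_real (\<mu> i) = of_real (\<Sum>f\<leftarrow>F. (cmod (cinner f (v i)))\<^sup>2)"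
      unfolding cinner_frame_op_self[symmetric] S by (simp add: cinner_scaleR_left onb_cinner[OF v])
    then show ?thesis using of_real_eq_iff by blast
  qed
  have le: "(cmod (cinner f x))\<^sup>2 \<le> (\<Sum>f\<leftarrow>F. (cmod (cinner f x))\<^sup>2)" if "f \<in> set F" for f x
    using that by (intro member_le_sum_list) auto
  show pos: "\<mu> i \<ge> 0" for i
    unfolding eq by (intro sum_list_nonneg) auto
  show zero: "cinner f (v i) = 0" if "f \<in> set F" "\<mu> i = 0" for f i
    using le[OF that(1), of "v i"] that(2) eq[of i] by simp
  show "(\<Sum>i\<in>UNIV. (cmod (cinner f (v i)))\<^sup>2 / \<mu> i) \<le> 1" if f: "f \<in> set F" for f
  proof -
    define t where "t = (\<Sum>i\<in>UNIV. (cmod (cinner f (v i)))\<^sup>2 / \<mu> i)"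
    define h where "h = (\<Sum>i\<in>UNIV. (cinner f (v i) / of_real (\<mu> i)) *s v i)"
    have t0: "t \<ge> 0" unfolding t_def by (intro sum_nonneg) (simp add: pos)
    have fh: "cinner f h = of_real t"
    proof -
      have "cinner f h = (\<Sum>i\<in>UNIV. cnj (cinner f (v i)) * cinner f (v i) / of_real (\<mu> i))"
        by (simp add: h_def cinner_sum_right cinner_mult_right)
      also have "\<dots> = of_real t"
        unfolding t_def of_real_sum
        by (intro sum.cong refl) (simp add: mult.commute flip: complex_norm_square)
      finally show ?thesis .
    qed
    have Sh: "frame_op F *v h = f"
    proof -
      have "frame_op F *v h = (\<Sum>i\<in>UNIV. (cinner f (v i) / of_real (\<mu> i)) *s (\<mu> i *\<^sub>R v i))"
        by (simp add: h_def vec.sum vec.scale S)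
      also have "\<dots> = (\<Sum>i\<in>UNIV. cinner f (v i) *s v i)"
        using zero[OF f] by (intro sum.cong refl) (auto simp: scaleR_eq_smult)
      also have "\<dots> = f" by (rule onb_expansion[OF v, symmetric])
      finally show ?thesis .
    qed
    have "(\<Sum>f\<leftarrow>F. (cmod (cinner f h))\<^sup>2) = t"
      using cinner_frame_op_self[of F h] unfolding Sh fh of_real_eq_iff by (rule sym)
    with le[OF f, of h] have "t\<^sup>2 \<le> t" using t0 by (simp add: fh)
    then show ?thesis using t0 unfolding t_def[symmetric]
      by (cases "t = 0") (auto simp: power2_eq_square)
  qed
qed

lemma sum_list_map_take_drop:
  fixes f :: "'a \<Rightarrow> real"
  shows "sum_list (map f (take j xs)) + sum_list (map f (drop j xs)) = sum_list (map f xs)"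
proof -
  have "sum_list (map f (take j xs @ drop j xs)) =
      sum_list (map f (take j xs)) + sum_list (map f (drop j xs))"
    by (simp only: map_append sum_list_append)
  then show ?thesis by (simp only: append_take_drop_id)
qed

text \<open>
  With the \<open>j\<close>-th largest entry as threshold, a sum of largest entries becomes an expression that
  depends only on the multiset of entries.
\<close>

lemma sum_list_take_threshold:
  fixes y :: "real list"
  assumes "sorted (rev y)" "0 < j" "j \<le> length y"
  shows "sum_list (take j y) = j * (y ! (j - 1)) + (\<Sum>x\<leftarrow>y. max (x - y ! (j - 1)) 0)"
proof -
  define t where "t = y ! (j - 1)"
  have anti: "y ! b \<le> y ! a" if "a \<le> b" "b < length y" for a b
    using sorted_rev_nth_mono[OF assms(1)] that by simp
  have "(\<Sum>x\<leftarrow>drop j y. max (x - t) 0) = (\<Sum>x\<leftarrow>drop j y. 0)"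
  proof (intro arg_cong[of _ _ sum_list] map_cong refl)
    fix x assume "x \<in> set (drop j y)"
    then obtain k where "k < length y - j" "x = y ! (j + k)"
      by (auto simp: in_set_conv_nth)
    with anti[of "j - 1" "j + k"] show "max (x - t) 0 = 0" by (simp add: t_def)
  qed
  moreover have "(\<Sum>x\<leftarrow>take j y. max (x - t) 0) = (\<Sum>x\<leftarrow>take j y. x - t)"
  proof (intro arg_cong[of _ _ sum_list] map_cong refl)
    fix x assume "x \<in> set (take j y)"
    then obtain k where "k < j" "x = y ! k"
      using assms(3) by (auto simp: in_set_conv_nth)
    with anti[of k "j - 1"] assms show "max (x - t) 0 = x - t" by (simp add: t_def)
  qed
  moreover have "(\<Sum>x\<leftarrow>take j y. x - t) = sum_list (take j y) - j * t"
    using assms(3) sum_list_subtractf[of "\<lambda>x. x" "\<lambda>_. t" "take j y"] by (simp add: sum_list_triv)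
  moreover have "(\<Sum>x\<leftarrow>y. max (x - t) 0) =
      (\<Sum>x\<leftarrow>take j y. max (x - t) 0) + (\<Sum>x\<leftarrow>drop j y. max (x - t) 0)"
    by (rule sum_list_map_take_drop[symmetric])
  ultimately show ?thesis by (simp add: t_def)
qed

lemma length_pad_zeros: "length xs \<le> n \<Longrightarrow> length (pad_zeros n xs) = n"
  by (simp add: pad_zeros_def)

lemma pad_zeros_nonneg: "(\<And>x. x \<in> set xs \<Longrightarrow> 0 \<le> x) \<Longrightarrow> x \<in> set (pad_zeros n xs) \<Longrightarrow> 0 \<le> x"
  by (auto simp: pad_zeros_def)

lemma sum_list_pad_zeros:
  fixes g :: "real \<Rightarrow> real"
  shows "g 0 = 0 \<Longrightarrow> sum_list (map g (pad_zeros n xs)) = sum_list (map g xs)"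
  by (simp add: pad_zeros_def sum_list_replicate)

lemma sum_list_map_mset_cong:
  fixes f :: "'a \<Rightarrow> real"
  shows "mset xs = mset ys \<Longrightarrow> sum_list (map f xs) = sum_list (map f ys)"
  by (simp flip: sum_mset_sum_list)

text \<open>
  Necessity in the Schur--Horn theorem. For the \<open>j\<close> longest vectors, the weights add up over these
  vectors to coefficients \<open>c\<close> in \<open>[0,1]\<close> with total at most \<open>j\<close>, and
  \<open>\<Sum> c\<^sub>i \<mu>\<^sub>i \<le> \<Sum> max (\<mu>\<^sub>i - t) 0 + j t\<close> for every \<open>t \<ge> 0\<close>; taking for \<open>t\<close> the \<open>j\<close>-th largest eigenvalue gives
  the sum of the \<open>j\<close> largest ones. Padding with zero vectors gives both lists the same length.
\<close>

lemma frame_norms_majorized: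
  fixes G :: "(complex ^ 'd::{finite,linorder}) list"
  assumes v: "onb v" and S: "\<And>i. frame_op G *v v i = (\<mu> $ i) *\<^sub>R v i"
  shows "map (\<lambda>g. (norm g)\<^sup>2) G \<prec>\<^sub>m vec_list \<mu>"
proof -
  define a where "a = map (\<lambda>g. (norm g)\<^sup>2) G"
  define n where "n = max (length a) (CARD('d))"
  define x where "x = dec_list (pad_zeros n a)"
  define y where "y = dec_list (pad_zeros n (vec_list \<mu>))"
  define G0 where "G0 = G @ replicate (n - length G) 0"
  have "mset (map (\<lambda>g. (norm g)\<^sup>2) G0) = mset x"
    by (simp add: x_def G0_def a_def pad_zeros_def map_replicate_const)
  then obtain H where H: "mset H = mset G0" "map (\<lambda>g. (norm g)\<^sup>2) H = x"
    using exists_permuted_list_map_eq by blast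
  have "frame_op H = frame_op G"
    using frame_op_mset_cong[OF H(1)] by (simp add: G0_def)
  with S have SH: "\<And>i. frame_op H *v v i = (\<mu> $ i) *\<^sub>R v i" by simp
  note sub = frame_norms_substochastic[OF v SH]
  have lenH: "length H = n" using H(2) by (metis length_dec_list length_map length_pad_zeros max.cobounded1 n_def x_def)
  have leny: "length y = n" by (simp add: y_def length_pad_zeros n_def)
  have ysum: "(\<Sum>z\<leftarrow>y. g z) = (\<Sum>i\<in>UNIV. g (\<mu> $ i))" if "g 0 = 0" for g :: "real \<Rightarrow> real"
    using sum_list_map_mset_cong[of y "pad_zeros n (vec_list \<mu>)" g] that
    by (simp add: y_def sum_list_pad_zeros sum_list_map_vec_list)
  have "sum_list (take j x) \<le> sum_list (take j y)" if j: "j \<le> n" for j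
  proof (cases "j = 0")
    case False
    define t where "t = y ! (j - 1)"
    have "t \<in> set y" using j False leny by (auto simp: t_def)
    also have "set y = set (pad_zeros n (vec_list \<mu>))"
      unfolding y_def by (metis mset_dec_list set_mset_mset)
    finally have t0: "0 \<le> t"
      by (intro pad_zeros_nonneg[of "vec_list \<mu>" t n]) (auto simp: vec_list_def sub(1))
    define c where "c i = (\<Sum>h\<leftarrow>take j H. (cmod (cinner h (v i)))\<^sup>2 / \<mu> $ i)" for i
    have c0: "0 \<le> c i" for i
      unfolding c_def by (intro sum_list_nonneg) (auto simp: sub(1))
    have c1: "c i \<le> 1" for i
    proof -
      have "c i \<le> c i + (\<Sum>h\<leftarrow>drop j H. (cmod (cinner h (v i)))\<^sup>2 / \<mu> $ i)"
        using sub(1)[of i] by (simp, intro sum_list_nonneg) auto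
      also have "\<dots> = (\<Sum>h\<leftarrow>H. (cmod (cinner h (v i)))\<^sup>2 / \<mu> $ i)"
        unfolding c_def by (rule sum_list_map_take_drop)
      also have "\<dots> = (\<Sum>h\<leftarrow>H. (cmod (cinner h (v i)))\<^sup>2) / \<mu> $ i"
        by (induction H) (simp_all add: add_divide_distrib)
      also have "\<dots> = \<mu> $ i / \<mu> $ i"
        by (simp only: sub(2)[of i, symmetric])
      also have "\<dots> \<le> 1" by simp
      finally show ?thesis .
    qed
    have swap: "(\<Sum>i\<in>UNIV. \<Sum>h\<leftarrow>L. g h i) = (\<Sum>h\<leftarrow>L. \<Sum>i\<in>UNIV. g h i)"
      for L :: "(complex, 'd) vec list" and g :: "_ \<Rightarrow> 'd \<Rightarrow> real"
      by (induction L) (simp_all add: sum.distrib)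
    have csum: "(\<Sum>i\<in>UNIV. c i) \<le> j"
    proof -
      have "(\<Sum>i\<in>UNIV. c i) \<le> (\<Sum>h\<leftarrow>take j H. 1)"
        unfolding c_def swap by (intro sum_list_mono sub(4)) (meson in_set_takeD)
      then show ?thesis using j by (simp add: sum_list_triv lenH)
    qed
    have "sum_list (take j x) = (\<Sum>h\<leftarrow>take j H. (norm h)\<^sup>2)"
      by (simp add: H(2)[symmetric] take_map)
    also have "\<dots> = (\<Sum>h\<leftarrow>take j H. \<Sum>i\<in>UNIV. (cmod (cinner h (v i)))\<^sup>2)"
      by (simp add: onb_norm_square[OF v])
    also have "\<dots> = (\<Sum>h\<leftarrow>take j H. \<Sum>i\<in>UNIV. (cmod (cinner h (v i)))\<^sup>2 / \<mu> $ i * \<mu> $ i)"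
      using sub(3) by (intro arg_cong[of _ _ sum_list] map_cong sum.cong refl)
        (fastforce dest: in_set_takeD)
    also have "\<dots> = (\<Sum>i\<in>UNIV. c i * \<mu> $ i)"
      unfolding swap[symmetric] by (simp only: c_def sum_list_mult_const)
    also have "\<dots> = (\<Sum>i\<in>UNIV. c i * (\<mu> $ i - t)) + (\<Sum>i\<in>UNIV. c i) * t"
      by (simp add: algebra_simps sum_subtractf sum_distrib_left)
    also have "\<dots> \<le> (\<Sum>i\<in>UNIV. max (\<mu> $ i - t) 0) + j * t"
    proof (intro add_mono sum_mono mult_right_mono csum t0)
      fix i
      show "c i * (\<mu> $ i - t) \<le> max (\<mu> $ i - t) 0"
        using c0[of i] c1[of i] mult_left_le_one_le[of "\<mu> $ i - t" "c i"]
        by (cases "\<mu> $ i - t \<ge> 0") (auto simp: max_def mult_nonneg_nonpos)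
    qed
    also have "\<dots> = sum_list (take j y)"
      using sum_list_take_threshold[of y j] False j leny ysum[of "\<lambda>z. max (z - t) 0"] t0
      by (simp add: t_def y_def)
    finally show ?thesis .
  qed simp
  moreover have "sum_list x = sum_list y"
  proof -
    have "sum_list x = (\<Sum>h\<leftarrow>H. (norm h)\<^sup>2)" by (simp add: H(2)[symmetric])
    also have "\<dots> = (\<Sum>h\<leftarrow>H. \<Sum>i\<in>UNIV. (cmod (cinner h (v i)))\<^sup>2)"
      by (simp add: onb_norm_square[OF v])
    also have "\<dots> = (\<Sum>i\<in>UNIV. \<Sum>h\<leftarrow>H. (cmod (cinner h (v i)))\<^sup>2)"
      by (induction H) (simp_all add: sum.distrib)
    also have "\<dots> = (\<Sum>i\<in>UNIV. \<mu> $ i)" by (simp add: sub(2)[symmetric])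
    finally show ?thesis using ysum[of "\<lambda>z. z"] by simp
  qed
  ultimately show ?thesis
    by (simp add: majorized_def Let_def a_def[symmetric] x_def y_def n_def)
qed

text \<open>
  Rotating the pair \<open>(g, h)\<close> by an angle \<open>\<theta>\<close> leaves the frame operator unchanged, and the squared norm
  of the first vector runs continuously from \<open>(norm g)\<^sup>2\<close> at \<open>\<theta> = 0\<close> to \<open>(norm h)\<^sup>2\<close> at \<open>\<theta> = \<pi> / 2\<close>.
\<close>

lemma rotate_frame_vectors:
  fixes g h :: "complex ^ 'd"
  assumes "(norm h)\<^sup>2 \<le> c" "c \<le> (norm g)\<^sup>2"
  shows "\<exists>g' h'. rank_one g' g' + rank_one h' h' = rank_one g g + rank_one h h \<and>
    (norm g')\<^sup>2 = c \<and> (norm h')\<^sup>2 = (norm g)\<^sup>2 + (norm h)\<^sup>2 - c"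
proof -
  define p where "p \<theta> = cos \<theta> *\<^sub>R g + sin \<theta> *\<^sub>R h" for \<theta>
  define q where "q \<theta> = cos \<theta> *\<^sub>R h - sin \<theta> *\<^sub>R g" for \<theta>
  have "\<exists>\<theta>. 0 \<le> \<theta> \<and> \<theta> \<le> pi / 2 \<and> (norm (p \<theta>))\<^sup>2 = c"
    using assms by (intro IVT2' continuous_intros) (auto simp: p_def intro!: continuous_intros)
  then obtain \<theta> where \<theta>: "(norm (p \<theta>))\<^sup>2 = c" by blast
  have cs: "(cos \<theta>)\<^sup>2 = 1 - (sin \<theta>)\<^sup>2" by (simp add: cos_squared_eq)
  have "(norm (p \<theta>))\<^sup>2 + (norm (q \<theta>))\<^sup>2 =
      (cos \<theta>)\<^sup>2 * ((norm g)\<^sup>2 + (norm h)\<^sup>2) + (sin \<theta>)\<^sup>2 * ((norm g)\<^sup>2 + (norm h)\<^sup>2)"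
    unfolding p_def q_def power2_norm_eq_inner
    by (simp add: inner_add_left inner_add_right inner_diff_left inner_diff_right inner_commute
        power2_eq_square algebra_simps)
  then have "(norm (q \<theta>))\<^sup>2 = (norm g)\<^sup>2 + (norm h)\<^sup>2 - c"
    by (simp add: \<theta> cs algebra_simps)
  moreover have "rank_one (p \<theta>) (p \<theta>) + rank_one (q \<theta>) (q \<theta>) = rank_one g g + rank_one h h"
  proof -
    define s where "s = complex_of_real (sin \<theta>)"
    define k where "k = complex_of_real (cos \<theta>)"
    have cnj: "cnj s = s" "cnj k = k" by (simp_all add: s_def k_def)
    have "k * k + s * s = 1"
      unfolding k_def s_def
      by (metis cos_squared_eq diff_add_cancel of_real_1 of_real_add of_real_mult power2_eq_square)
    then have *: "(k * a + s * b) * (k * c + s * d) + (k * b - s * a) * (k * d - s * c) = a * c + b * d"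
      for a b c d by algebra
    show ?thesis
      unfolding p_def q_def scaleR_eq_smult s_def[symmetric] k_def[symmetric]
      using * by (simp add: vec_eq_iff rank_one_nth cnj)
  qed
  ultimately show ?thesis using \<theta> by blast
qed

text \<open>
  The head of \<open>x\<close> is produced by rotating the first vector against the first vector whose squared
  norm is at most that head. Only prefix sums of the squared norms enter the hypothesis, so the
  list of vectors need not be kept sorted: prefixes that end before the rotated partner consist of
  squared norms above the head, which dominates all of \<open>x\<close>, and longer prefixes keep their sums.
\<close>

lemma frame_with_dominated_norms:
  fixes G :: "(complex ^ 'd) list"
  assumes "length G = length x" "sorted (rev x)"
    and "\<And>j. j \<le> length x \<Longrightarrow> sum_list (take j x) \<le> (\<Sum>g\<leftarrow>take j G. (norm g)\<^sup>2)"
    and "sum_list x = (\<Sum>g\<leftarrow>G. (norm g)\<^sup>2)"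
  shows "\<exists>H. map (\<lambda>g. (norm g)\<^sup>2) H = x \<and> frame_op H = frame_op G"
  using assms
proof (induction x arbitrary: G)
  case (Cons c x)
  then obtain g G1 where G: "G = g # G1" "length G1 = length x" by (cases G) auto
  let ?q = "\<lambda>g. (norm g)\<^sup>2"
  have sx: "sorted (rev x)" and xc: "\<And>z. z \<in> set x \<Longrightarrow> z \<le> c"
    using Cons.prems(2) by (auto simp: sorted_append)
  have cg: "c \<le> ?q g" using Cons.prems(3)[of 1] by (simp add: G)
  have tot: "c + sum_list x = ?q g + (\<Sum>g\<leftarrow>G1. ?q g)" using Cons.prems(4) by (simp add: G)
  have pre: "c + sum_list (take j x) \<le> ?q g + (\<Sum>g\<leftarrow>take j G1. ?q g)" if "j \<le> length x" for j
    using Cons.prems(3)[of "Suc j"] that by (simp add: G)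
  show ?case
  proof (cases "?q g = c")
    case True
    have "\<exists>H. map ?q H = x \<and> frame_op H = frame_op G1"
      using pre tot True by (intro Cons.IH G(2) sx) auto
    then obtain H where "map ?q H = x" "frame_op H = frame_op G1" by blast
    then show ?thesis using True by (intro exI[of _ "g # H"]) (simp add: G)
  next
    case False
    with cg have cg': "c < ?q g" by simp
    have "\<exists>h\<in>set G1. ?q h \<le> c"
    proof (rule ccontr)
      assume "\<not> ?thesis"
      then have "(\<Sum>g\<leftarrow>G1. ?q g) \<ge> (\<Sum>g\<leftarrow>G1. c)"
        by (intro sum_list_mono) auto
      moreover have "sum_list x \<le> (\<Sum>z\<leftarrow>x. c)"
        using sum_list_mono[of x "\<lambda>z. z" "\<lambda>_. c"] xc by simp
      ultimately show False using tot cg' G(2) by (simp add: sum_list_triv)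
    qed
    then obtain U h W where UW: "G1 = U @ h # W" "?q h \<le> c" "\<forall>u\<in>set U. \<not> ?q u \<le> c"
      using split_list_first_prop[of G1 "\<lambda>h. ?q h \<le> c"] by blast
    obtain g' h' where gh: "rank_one g' g' + rank_one h' h' = rank_one g g + rank_one h h"
      "?q g' = c" "?q h' = ?q g + ?q h - c"
      using rotate_frame_vectors[OF UW(2) cg] by blast
    have "\<exists>H. map ?q H = x \<and> frame_op H = frame_op (U @ h' # W)"
    proof (rule Cons.IH)
      show "length (U @ h' # W) = length x" using G(2) UW(1) by simp
      show "sum_list x = (\<Sum>g\<leftarrow>U @ h' # W. ?q g)" using tot by (simp add: UW(1) gh(3))
      fix j assume j: "j \<le> length x"
      show "sum_list (take j x) \<le> (\<Sum>g\<leftarrow>take j (U @ h' # W). ?q g)"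
      proof (cases "j \<le> length U")
        case True
        have "sum_list (take j x) \<le> (\<Sum>z\<leftarrow>take j x. c)"
          using sum_list_mono[of "take j x" "\<lambda>z. z" "\<lambda>_. c"] xc by (auto dest: in_set_takeD)
        also have "\<dots> = (\<Sum>g\<leftarrow>take j U. c)" using True j by (simp add: sum_list_triv)
        also have "\<dots> \<le> (\<Sum>g\<leftarrow>take j U. ?q g)"
          using UW(3) by (intro sum_list_mono) (force dest: in_set_takeD)
        finally show ?thesis using True by simp
      next
        case False
        then obtain k where "j = Suc (length U + k)"
          by (metis add_Suc_right less_imp_Suc_add not_le)
        then show ?thesis using pre[OF j] by (simp add: UW(1) gh(3))
      qed
    qed (rule sx)
    then obtain H where "map ?q H = x" "frame_op H = frame_op (U @ h' # W)" by blast
    then show ?thesis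
      using gh by (intro exI[of _ "g' # H"]) (simp add: G UW(1) algebra_simps)
  qed
qed simp

text \<open>
  Sufficiency in the Schur--Horn theorem. The vectors \<open>sqrt \<mu>\<^sub>i v\<^sub>i\<close>, padded with zero vectors, have the
  spectrum as squared norms. If the padded \<open>a\<close> is longer than \<open>a\<close>, the vectors produced for its
  additional entries are zero and can be dropped.
\<close>

lemma frame_with_majorized_norms:
  fixes v :: "'d::{finite,linorder} \<Rightarrow> (complex, 'd) vec"
  assumes maj: "a \<prec>\<^sub>m vec_list \<mu>" and pos: "\<And>i. 0 \<le> \<mu> $ i" and v: "onb v"
  shows "\<exists>G. map (\<lambda>g. (norm g)\<^sup>2) G = a \<and>
    frame_op G = (\<Sum>i\<in>UNIV. (\<mu> $ i) *\<^sub>R rank_one (v i) (v i))"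
proof -
  let ?q = "\<lambda>g :: (complex, 'd) vec. (norm g)\<^sup>2"
  define n where "n = max (length a) (CARD('d))"
  define x where "x = dec_list (pad_zeros n a)"
  define y where "y = dec_list (pad_zeros n (vec_list \<mu>))"
  have xy: "\<And>j. j \<le> n \<Longrightarrow> sum_list (take j x) \<le> sum_list (take j y)" "sum_list x = sum_list y"
    using maj by (simp_all add: majorized_def Let_def x_def y_def n_def)
  define L where "L = map (\<lambda>i. sqrt (\<mu> $ i) *\<^sub>R v i) (sorted_list_of_set UNIV)"
  have "map ?q L = vec_list \<mu>"
    by (simp add: L_def vec_list_def onb_norm_1[OF v] pos power_mult_distrib)
  moreover have "length L = CARD('d)" by (simp add: L_def)
  ultimately have "mset (map ?q (L @ replicate (n - CARD('d)) 0)) = mset y"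
    by (simp add: y_def pad_zeros_def map_replicate_const)
  then obtain G0 where G0: "mset G0 = mset (L @ replicate (n - CARD('d)) 0)" "map ?q G0 = y"
    using exists_permuted_list_map_eq by blast
  have "frame_op G0 = frame_op L"
    using frame_op_mset_cong[OF G0(1)] by simp
  also have "\<dots> = (\<Sum>i\<in>UNIV. rank_one (sqrt (\<mu> $ i) *\<^sub>R v i) (sqrt (\<mu> $ i) *\<^sub>R v i))"
    by (simp add: frame_op_def L_def o_def sum_list_distinct_conv_sum_set)
  also have "\<dots> = (\<Sum>i\<in>UNIV. (\<mu> $ i) *\<^sub>R rank_one (v i) (v i))"
    using pos by (simp add: rank_one_scaleR)
  finally have SG0: "frame_op G0 = (\<Sum>i\<in>UNIV. (\<mu> $ i) *\<^sub>R rank_one (v i) (v i))" .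
  have lx: "length x = n" by (simp add: x_def length_pad_zeros n_def)
  have ly: "length y = n" by (simp add: y_def length_pad_zeros n_def)
  have lG0: "length G0 = n" using G0(2) ly by (metis length_map)
  obtain H where H: "map ?q H = x" "frame_op H = frame_op G0"
    using frame_with_dominated_norms[of G0 x] lx lG0 xy G0(2)
    by (auto simp: x_def simp flip: take_map)
  have "mset (map ?q H) = mset (pad_zeros n a)" by (simp add: H(1) x_def)
  then obtain H' where H': "mset H' = mset H" "map ?q H' = pad_zeros n a"
    using exists_permuted_list_map_eq by blast
  define G where "G = take (length a) H'"
  have Ga: "map ?q G = a" by (simp add: G_def H'(2) pad_zeros_def flip: take_map)
  have dr: "map ?q (drop (length a) H') = replicate (n - length a) 0"
    by (simp add: H'(2) pad_zeros_def flip: drop_map)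
  have "drop (length a) H' = replicate (n - length a) 0"
  proof (rule replicate_eqI)
    show "length (drop (length a) H') = n - length a"
      using arg_cong[OF dr, of length] by simp
    fix h assume "h \<in> set (drop (length a) H')"
    then have "?q h \<in> set (map ?q (drop (length a) H'))" by simp
    then show "h = 0" unfolding dr by (auto dest: in_set_replicate[THEN iffD1])
  qed
  then have "frame_op H' = frame_op G"
    unfolding G_def by (metis add.right_neutral append_take_drop_id frame_op_append frame_op_replicate_zero)
  with SG0 H(2) frame_op_mset_cong[OF H'(1)] Ga show ?thesis by metis
qed

section \<open>The polytope of admissible spectra\<close>

text \<open>
  Padding appends zeros, which come last in decreasing order because \<open>\<mu>\<close> is nonnegative. Hence the
  \<open>j\<close> largest entries of an increasing \<open>\<mu>\<close> sit at its last \<open>j\<close> indices \<open>I j\<close>, independently of \<open>\<mu>\<close>, and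
  all conditions become linear.
\<close>

lemma Gamma_set_eq:
  fixes a :: "real list"
  defines "n \<equiv> max (length a) (CARD('d::{finite,linorder}))"
  defines "x \<equiv> dec_list (pad_zeros n a)"
  defines "I \<equiv> \<lambda>j. set (take j (rev (sorted_list_of_set (UNIV :: 'd set))))"
  shows "Gamma_set a = {\<mu> :: (real, 'd) vec. (\<forall>i. 0 \<le> \<mu> $ i) \<and> (\<forall>i j. i \<le> j \<longrightarrow> \<mu> $ i \<le> \<mu> $ j) \<and>
         (\<forall>j. j \<le> n \<longrightarrow> sum_list (take j x) \<le> (\<Sum>i\<in>I j. \<mu> $ i)) \<and> sum_list x = (\<Sum>i\<in>UNIV. \<mu> $ i)}"
proof -
  have "a \<prec>\<^sub>m vec_list \<mu> \<longleftrightarrow> (\<forall>j. j \<le> n \<longrightarrow> sum_list (take j x) \<le> (\<Sum>i\<in>I j. \<mu> $ i)) \<and> sum_list x = (\<Sum>i\<in>UNIV. \<mu> $ i)"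
    if pos: "\<forall>i. 0 \<le> \<mu> $ i" and mono: "\<forall>i j. i \<le> j \<longrightarrow> \<mu> $ i \<le> \<mu> $ j" for \<mu> :: "(real, 'd) vec"
  proof -
    let ?e = "sorted_list_of_set (UNIV :: 'd set)"
    define z where "z = replicate (n - CARD('d)) (0 :: real)"
    have "dec_list (pad_zeros n (vec_list \<mu>)) = dec_list (rev (vec_list \<mu>) @ z)"
      by (intro dec_list_cong) (simp add: pad_zeros_def z_def)
    also have "\<dots> = rev (vec_list \<mu>) @ z"
    proof (rule dec_list_eq)
      have "sorted (vec_list \<mu>)" using mono by (simp add: sorted_vec_list_iff)
      then show "sorted (rev (rev (vec_list \<mu>) @ z))"
        using pos by (auto simp: sorted_append z_def vec_list_def)
    qed
    finally have dec: "dec_list (pad_zeros n (vec_list \<mu>)) = rev (vec_list \<mu>) @ z" .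
    have "sum_list (take j (rev (vec_list \<mu>) @ z)) = (\<Sum>i\<in>I j. \<mu> $ i)" for j
    proof -
      have "take j (rev (vec_list \<mu>)) = map (($) \<mu>) (take j (rev ?e))"
        by (simp add: vec_list_def rev_map take_map)
      moreover have "distinct (take j (rev ?e))" by simp
      ultimately have "sum_list (take j (rev (vec_list \<mu>))) = (\<Sum>i\<in>I j. \<mu> $ i)"
        unfolding I_def by (simp only: sum_list_distinct_conv_sum_set)
      moreover have "sum_list (take (j - CARD('d)) z) = 0"
        by (simp add: z_def sum_list_replicate)
      ultimately show ?thesis by simp
    qed
    moreover have "sum_list (rev (vec_list \<mu>) @ z) = (\<Sum>i\<in>UNIV. \<mu> $ i)"
      using sum_list_map_vec_list[of "\<lambda>x. x" \<mu>] by (simp add: z_def sum_list_replicate)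
    ultimately show ?thesis
      by (simp add: majorized_def Let_def dec x_def n_def[symmetric])
  qed
  note maj = this
  show ?thesis
    unfolding Gamma_set_def inc_vec_fixed_iff
    by (intro Collect_cong conj_cong refl) (rule maj)
qed

lemma convex_Gamma_set: "convex (Gamma_set a :: (real, 'd::{finite,linorder}) vec set)"
proof (rule convexI)
  let ?x = "dec_list (pad_zeros (max (length a) CARD('d)) a)"
  let ?I = "\<lambda>j. set (take j (rev (sorted_list_of_set (UNIV :: 'd set))))"
  fix x y :: "(real, 'd) vec" and u v :: real
  assume uv: "0 \<le> u" "0 \<le> v" "u + v = 1" and "x \<in> Gamma_set a" "y \<in> Gamma_set a"
  note mem = this(4,5)[unfolded Gamma_set_eq mem_Collect_eq]
  have pos: "0 \<le> x $ i" "0 \<le> y $ i" for i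
    using mem by simp_all
  have mono: "x $ i \<le> x $ k" "y $ i \<le> y $ k" if "i \<le> k" for i k
    using mem that by simp_all
  have le: "sum_list (take j ?x) \<le> (\<Sum>i\<in>?I j. x $ i)" "sum_list (take j ?x) \<le> (\<Sum>i\<in>?I j. y $ i)"
    if "j \<le> max (length a) CARD('d)" for j
    using mem that by blast+
  have eq: "sum_list ?x = (\<Sum>i\<in>UNIV. x $ i)" "sum_list ?x = (\<Sum>i\<in>UNIV. y $ i)"
    using mem by simp_all
  have sum: "(\<Sum>i\<in>J. (u *\<^sub>R x + v *\<^sub>R y) $ i) = u * (\<Sum>i\<in>J. x $ i) + v * (\<Sum>i\<in>J. y $ i)" for J
    by (simp add: sum.distrib sum_distrib_left)
  have split: "c = u * c + v * c" for c
    using uv(3) by (metis distrib_right mult_1)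
  show "u *\<^sub>R x + v *\<^sub>R y \<in> Gamma_set a"
    unfolding Gamma_set_eq mem_Collect_eq sum
  proof (intro conjI allI impI)
    fix i j :: 'd
    show "0 \<le> (u *\<^sub>R x + v *\<^sub>R y) $ i" using pos uv by simp
    show "(u *\<^sub>R x + v *\<^sub>R y) $ i \<le> (u *\<^sub>R x + v *\<^sub>R y) $ j" if "i \<le> j"
      using mono[OF that] uv by (auto intro!: add_mono mult_left_mono)
  next
    fix j
    assume "j \<le> max (length a) CARD('d)"
    from le[OF this] uv show "sum_list (take j ?x) \<le> u * (\<Sum>i\<in>?I j. x $ i) + v * (\<Sum>i\<in>?I j. y $ i)"
      by (subst split) (intro add_mono mult_left_mono)
  next
    show "sum_list ?x = u * (\<Sum>i\<in>UNIV. x $ i) + v * (\<Sum>i\<in>UNIV. y $ i)"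
      unfolding eq(1,2)[symmetric] by (rule split)
  qed
qed

lemma compact_Gamma_set: "compact (Gamma_set a :: (real, 'd::{finite,linorder}) vec set)"
proof -
  define s where "s = sum_list (dec_list (pad_zeros (max (length a) CARD('d)) a))"
  have "closed (Gamma_set a :: (real, 'd) vec set)"
    unfolding Gamma_set_eq
    by (intro closed_Collect_conj closed_Collect_all closed_Collect_imp open_Collect_const
        closed_Collect_le closed_Collect_eq continuous_intros)
  moreover have "bounded (Gamma_set a :: (real, 'd) vec set)"
  proof (rule bounded_subset[OF bounded_cball])
    show "(Gamma_set a :: (real, 'd) vec set) \<subseteq> cball 0 s"
    proof
      fix \<mu> :: "(real, 'd) vec"
      assume "\<mu> \<in> Gamma_set a"
      then have "\<forall>i. 0 \<le> \<mu> $ i" "s = (\<Sum>i\<in>UNIV. \<mu> $ i)"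
        unfolding Gamma_set_eq s_def by auto
      then show "\<mu> \<in> cball 0 s"
        using norm_le_l1_cart[of \<mu>] by simp
    qed
  qed
  ultimately show ?thesis by (simp add: compact_eq_bounded_closed)
qed

lemma compact_convex_Lambda_op:
  "compact (Lambda_op a lam) \<and> convex (Lambda_op a lam)"
proof -
  have "Lambda_op a lam = (+) (dec_vec lam) ` Gamma_set a"
    by (auto simp: Lambda_op_def)
  then show ?thesis
    by (simp add: compact_translation convex_translation compact_Gamma_set convex_Gamma_set)
qed

section \<open>The equality case of the rearrangement inequality\<close>

text \<open>
  A dual solution of the transport problem with cost \<open>f i * g j\<close>: subject to doubly stochastic
  weights, the diagonal is optimal because \<open>\<beta>\<close> certifies it. The slack \<open>gap i j\<close> is a sum over the steps
  \<open>t\<close> between \<open>i\<close> and \<open>j\<close>. Any slope of \<open>\<beta>\<close> between \<open>f (Suc t)\<close> and \<open>f t\<close> relative to \<open>g\<close> would make these summands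
  nonnegative; the midpoint makes a summand vanish only if \<open>g\<close> stays constant in that step or \<open>f\<close>
  still has the value \<open>f i\<close> at both ends. So slack zero means that on the way from \<open>i\<close> to \<open>j\<close> the function \<open>g\<close>
  changes only as long as \<open>f\<close> keeps the value \<open>f i\<close>, and \<open>m\<close> is the point where \<open>g\<close> changes last.
\<close>

lemma rearrangement_potential_nat:
  fixes f g :: "nat \<Rightarrow> real"
  assumes f: "\<And>i j. i \<le> j \<Longrightarrow> j < n \<Longrightarrow> f j \<le> f i"
    and g: "\<And>i j. i \<le> j \<Longrightarrow> j < n \<Longrightarrow> g i \<le> g j"
  shows "\<exists>\<beta>. \<forall>i<n. \<forall>j<n. \<beta> j - \<beta> i \<le> f i * (g j - g i) \<and>
    (\<beta> j - \<beta> i = f i * (g j - g i) \<longrightarrow> (\<exists>m<n. f m = f i \<and> g m = g j))"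
proof -
  define \<beta> where "\<beta> k = (\<Sum>t<k. (f t + f (Suc t)) / 2 * (g (Suc t) - g t))" for k
  define gap where "gap i j = f i * (g j - g i) - (\<beta> j - \<beta> i)" for i j
  have gap_Suc: "gap i (Suc j) = gap i j + (f i - (f j + f (Suc j)) / 2) * (g (Suc j) - g j)" for i j
    by (simp add: gap_def \<beta>_def algebra_simps)
  have gap_self: "gap i i = 0" for i by (simp add: gap_def)
  have "0 \<le> gap i j \<and> (gap i j = 0 \<longrightarrow> (\<exists>m<n. f m = f i \<and> g m = g j))"
    if i: "i < n" and j: "j < n" for i j
  proof (cases "i \<le> j")
    case True
    then show ?thesis using j
    proof (induction j rule: dec_induct)
      case base
      then show ?case by (auto simp: gap_self)
    next
      case (step k)
      then have IH: "0 \<le> gap i k" "gap i k = 0 \<Longrightarrow> \<exists>m<n. f m = f i \<and> g m = g k" by auto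
      have fk: "f k \<le> f i" "f (Suc k) \<le> f i" using f step by auto
      have gk: "g k \<le> g (Suc k)" using g step by auto
      let ?d = "(f i - (f k + f (Suc k)) / 2) * (g (Suc k) - g k)"
      have d: "0 \<le> ?d" using fk gk by (intro mult_nonneg_nonneg) auto
      have "\<exists>m<n. f m = f i \<and> g m = g (Suc k)" if "gap i (Suc k) = 0"
      proof -
        have z: "gap i k = 0" "?d = 0" using that IH(1) d unfolding gap_Suc by linarith+
        show ?thesis
        proof (cases "g (Suc k) = g k")
          case True
          then show ?thesis using IH(2)[OF z(1)] by simp
        next
          case False
          with z(2) have "f (Suc k) = f i" using fk by auto
          with step.prems show ?thesis by blast
        qed
      qed
      with d IH(1) show ?case by (simp add: gap_Suc)
    qed
  next
    case False
    then have "j \<le> i" by simp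
    then show ?thesis
    proof (induction rule: inc_induct)
      case base
      show ?case using i by (auto simp: gap_self)
    next
      case (step k)
      have fk: "f i \<le> f k" "f i \<le> f (Suc k)" using f step i by auto
      have gk: "g k \<le> g (Suc k)" using g step i by auto
      let ?d = "((f k + f (Suc k)) / 2 - f i) * (g (Suc k) - g k)"
      have d: "0 \<le> ?d" using fk gk by (intro mult_nonneg_nonneg) auto
      have eq: "gap i k = gap i (Suc k) + ?d"
        unfolding gap_Suc[of i k] by (simp add: algebra_simps)
      have "\<exists>m<n. f m = f i \<and> g m = g k" if "gap i k = 0"
      proof -
        have z: "gap i (Suc k) = 0" "?d = 0" using that step.IH d unfolding eq by linarith+
        show ?thesis
        proof (cases "g (Suc k) = g k")
          case True
          then show ?thesis using step.IH z(1) by simp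
        next
          case False
          with z(2) have "f k = f i" using fk by auto
          with step.hyps i show ?thesis by (metis less_trans)
        qed
      qed
      with d step.IH show ?case by (simp add: eq)
    qed
  qed
  then show ?thesis
    by (intro exI[of _ \<beta>] allI impI) (fastforce simp: gap_def)
qed

text \<open>
  Complementary slackness: the average of the nonnegative slack with respect to an optimal \<open>D\<close> is
  zero, so the slack vanishes on the support of \<open>D\<close>.
\<close>

lemma rearrangement_equality_support:
  fixes lam mu :: "(real, 'd::{finite,linorder}) vec"
  assumes lam: "\<And>i j. i \<le> j \<Longrightarrow> lam $ j \<le> lam $ i" and mu: "\<And>i j. i \<le> j \<Longrightarrow> mu $ i \<le> mu $ j"
    and D: "\<And>i j. 0 \<le> D i j" "\<And>i. (\<Sum>j\<in>UNIV. D i j) = 1" "\<And>j. (\<Sum>i\<in>UNIV. D i j) = 1"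
    and eq: "(\<Sum>i\<in>UNIV. \<Sum>j\<in>UNIV. lam $ i * mu $ j * D i j) = (\<Sum>i\<in>UNIV. lam $ i * mu $ i)"
    and nz: "D i j \<noteq> 0"
  shows "\<exists>m. lam $ m = lam $ i \<and> mu $ m = mu $ j"
proof -
  have sl: "sorted (rev (vec_list lam))" "sorted (vec_list mu)"
    using lam mu by (simp_all add: sorted_rev_vec_list_iff sorted_vec_list_iff)
  obtain \<beta> where \<beta>: "\<forall>i<CARD('d). \<forall>j<CARD('d).
      \<beta> j - \<beta> i \<le> vec_list lam ! i * (vec_list mu ! j - vec_list mu ! i) \<and>
      (\<beta> j - \<beta> i = vec_list lam ! i * (vec_list mu ! j - vec_list mu ! i) \<longrightarrow>
       (\<exists>m<CARD('d). vec_list lam ! m = vec_list lam ! i \<and> vec_list mu ! m = vec_list mu ! j))"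
    using rearrangement_potential_nat[of "CARD('d)" "(!) (vec_list lam)" "(!) (vec_list mu)"]
      sorted_rev_nth_mono[OF sl(1)] sorted_nth_mono[OF sl(2)] by auto
  define b where "b i = \<beta> (pos_of i)" for i :: 'd
  define gap where "gap i j = lam $ i * (mu $ j - mu $ i) - (b j - b i)" for i j
  have gap0: "0 \<le> gap i j" for i j
    using \<beta>[rule_format, OF pos_of_less[of i] pos_of_less[of j]] by (simp add: gap_def b_def)
  have gapz: "\<exists>m. lam $ m = lam $ i \<and> mu $ m = mu $ j" if "gap i j = 0" for i j
  proof -
    have "\<beta> (pos_of j) - \<beta> (pos_of i) = lam $ i * (mu $ j - mu $ i)"
      using that by (simp add: gap_def b_def)
    then obtain m where m: "m < CARD('d)" "vec_list lam ! m = lam $ i" "vec_list mu ! m = mu $ j"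
      using \<beta>[rule_format, OF pos_of_less[of i] pos_of_less[of j]] by auto
    obtain k :: 'd where "m = pos_of k"
      using m(1) bij_betw_pos_of[where 'd = 'd] by (auto simp: bij_betw_def)
    with m show ?thesis by auto
  qed
  have "(\<Sum>i\<in>UNIV. \<Sum>j\<in>UNIV. D i j * gap i j) =
      (\<Sum>i\<in>UNIV. \<Sum>j\<in>UNIV. lam $ i * mu $ j * D i j) - (\<Sum>i\<in>UNIV. (lam $ i * mu $ i - b i) * (\<Sum>j\<in>UNIV. D i j))
        - (\<Sum>i\<in>UNIV. \<Sum>j\<in>UNIV. b j * D i j)"
    by (simp add: gap_def algebra_simps sum_subtractf sum.distrib sum_distrib_left)
  also have "(\<Sum>i\<in>UNIV. \<Sum>j\<in>UNIV. b j * D i j) = (\<Sum>j\<in>UNIV. b j * (\<Sum>i\<in>UNIV. D i j))"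
    by (subst sum.swap) (simp add: sum_distrib_left)
  finally have "(\<Sum>i\<in>UNIV. \<Sum>j\<in>UNIV. D i j * gap i j) = 0"
    by (simp add: D(2,3) eq sum_subtractf)
  then have "D i j * gap i j = 0"
    using D(1) gap0 by (simp add: sum_nonneg_eq_0_iff sum_nonneg)
  with nz gapz show ?thesis by simp
qed

section \<open>The equality case of Lidskii's inequality\<close>

text \<open>
  The Frobenius norm is the same in all orthonormal bases; by Parseval's identity it can be moved
  from the basis \<open>u\<close> to an eigenbasis \<open>e\<close>.
\<close>

lemma hermitian_frobenius:
  assumes u: "onb u" and e: "onb e" and M: "hermitian M" and Me: "\<And>j. M *v e j = c j *\<^sub>R e j"
  shows "(\<Sum>i\<in>UNIV. (norm (M *v u i))\<^sup>2) = (\<Sum>j\<in>UNIV. (c j)\<^sup>2)"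
proof -
  have "(norm (M *v u i))\<^sup>2 = (\<Sum>j\<in>UNIV. (c j)\<^sup>2 * (cmod (cinner (e j) (u i)))\<^sup>2)" for i
    by (simp add: onb_norm_square[OF e] hermitianD[OF M] Me cinner_scaleR_right norm_mult
        power_mult_distrib cmod_cinner_commute[of "e _"])
  then have "(\<Sum>i\<in>UNIV. (norm (M *v u i))\<^sup>2) =
      (\<Sum>j\<in>UNIV. (c j)\<^sup>2 * (\<Sum>i\<in>UNIV. (cmod (cinner (e j) (u i)))\<^sup>2))"
    by (simp add: sum_distrib_left) (rule sum.swap)
  then show ?thesis
    by (simp add: onb_norm_square[OF u, symmetric] onb_norm_1[OF e])
qed

lemma hermitian_eigenvectors_orthogonal:
  assumes "hermitian M" "M *v x = a *\<^sub>R x" "M *v y = b *\<^sub>R y" "cinner x y \<noteq> 0"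
  shows "a = b"
  using hermitianD[OF assms(1), of x y] assms by (simp add: cinner_scaleR_left cinner_scaleR_right)

text \<open>
  Equality in Lidskii's inequality turns into equality in the rearrangement inequality by
  comparing Frobenius norms. The support condition on the overlaps of the two eigenbases then
  yields commutation: every \<open>w\<^sub>j\<close> that overlaps both \<open>u\<^sub>i\<close> and \<open>u\<^sub>k\<close>, for \<open>\<lambda>\<^sub>i \<noteq> \<lambda>\<^sub>k\<close>, belongs to one and the
  same eigenvalue \<open>b\<close> of \<open>B\<close>, whence \<open>\<langle>B u\<^sub>i, u\<^sub>k\<rangle> = b \<langle>u\<^sub>i, u\<^sub>k\<rangle> = 0\<close>.
\<close>

lemma lidskii_equality_joint_eigenbasis:
  fixes A B :: "((complex, 'd::{finite,linorder}) vec, 'd) vec"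
  assumes A: "hermitian A" and B: "hermitian B"
    and eq: "eigvals (A + B) = dec_vec (eigvals A + eigvals_inc B)"
  shows "\<exists>v. onb v \<and> (\<forall>i. A *v v i = (eigvals A $ i) *\<^sub>R v i \<and> B *v v i = (eigvals_inc B $ i) *\<^sub>R v i)"
proof -
  define lam where "lam = eigvals A"
  define mu where "mu = eigvals_inc B"
  obtain u where u: "onb u" "\<And>i. A *v u i = (lam $ i) *\<^sub>R u i"
    using hermitian_eigenbasis[OF A] by (auto simp: lam_def)
  obtain w where w: "onb w" "\<And>i. B *v w i = (mu $ i) *\<^sub>R w i"
    using hermitian_eigenbasis_inc[OF B] by (auto simp: mu_def)
  obtain e where e: "onb e" "\<And>i. (A + B) *v e i = (dec_vec (lam + mu) $ i) *\<^sub>R e i"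
    using hermitian_eigenbasis[OF hermitian_add[OF A B]] by (auto simp: eq lam_def mu_def)
  have lam_dec: "lam $ j \<le> lam $ i" if "i \<le> j" for i j
    using dec_vec_antimono[OF that, of lam] dec_vec_eigvals[OF A] by (simp add: lam_def)
  have mu_inc: "mu $ i \<le> mu $ j" if "i \<le> j" for i j
    using inc_vec_mono[OF that] by (simp add: mu_def eigvals_inc_def)
  define D where "D i j = (cmod (cinner (u i) (w j)))\<^sup>2" for i j
  have uBu: "u i \<bullet> (B *v u i) = (\<Sum>j\<in>UNIV. mu $ j * D i j)" for i
  proof -
    have "cinner (w j) (B *v u i) = of_real (mu $ j) * cinner (w j) (u i)" for j
      unfolding hermitianD[OF B, of "w j", symmetric] by (simp add: w(2) cinner_scaleR_left)
    then have "cinner (u i) (B *v u i) = (\<Sum>j\<in>UNIV. of_real (mu $ j) * (cinner (u i) (w j) * cinner (w j) (u i)))"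
      by (simp add: onb_parseval[OF w(1), of "u i" "B *v u i"] mult.left_commute)
    then have "cinner (u i) (B *v u i) = of_real (\<Sum>j\<in>UNIV. mu $ j * D i j)"
      by (simp add: cinner_mult_cinner_swap D_def)
    then show ?thesis by (metis Re_cinner Re_complex_of_real)
  qed
  have "(\<Sum>i\<in>UNIV. (dec_vec (lam + mu) $ i)\<^sup>2) = (\<Sum>i\<in>UNIV. ((lam + mu) $ i)\<^sup>2)"
    unfolding sum_list_map_vec_list[of "\<lambda>x. x\<^sup>2", symmetric]
    by (rule sum_list_map_mset_cong) (simp add: vec_list_dec_vec)
  also have "\<dots> = (\<Sum>i\<in>UNIV. (lam $ i)\<^sup>2) + (\<Sum>i\<in>UNIV. (mu $ i)\<^sup>2) + 2 * (\<Sum>i\<in>UNIV. lam $ i * mu $ i)"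
    by (simp add: power2_sum sum.distrib sum_distrib_left mult.assoc)
  finally have 1: "(\<Sum>i\<in>UNIV. (norm ((A + B) *v u i))\<^sup>2) =
      (\<Sum>i\<in>UNIV. (lam $ i)\<^sup>2) + (\<Sum>i\<in>UNIV. (mu $ i)\<^sup>2) + 2 * (\<Sum>i\<in>UNIV. lam $ i * mu $ i)"
    by (simp add: hermitian_frobenius[OF u(1) e(1) hermitian_add[OF A B] e(2)])
  have "(norm ((A + B) *v u i))\<^sup>2 = (norm (A *v u i))\<^sup>2 + (norm (B *v u i))\<^sup>2 +
      2 * (lam $ i * (\<Sum>j\<in>UNIV. mu $ j * D i j))" for i
    unfolding power2_norm_eq_inner matrix_vector_mult_add_rdistrib uBu[symmetric]
    by (simp add: inner_add_left inner_add_right u(2) inner_commute)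
  then have 2: "(\<Sum>i\<in>UNIV. (norm ((A + B) *v u i))\<^sup>2) =
      (\<Sum>i\<in>UNIV. (lam $ i)\<^sup>2) + (\<Sum>i\<in>UNIV. (mu $ i)\<^sup>2)
        + 2 * (\<Sum>i\<in>UNIV. lam $ i * (\<Sum>j\<in>UNIV. mu $ j * D i j))"
    by (simp add: sum.distrib hermitian_frobenius[OF u(1) u(1) A u(2)]
        hermitian_frobenius[OF u(1) w(1) B w(2)] sum_distrib_left)
  have "(\<Sum>i\<in>UNIV. \<Sum>j\<in>UNIV. lam $ i * mu $ j * D i j) = (\<Sum>i\<in>UNIV. lam $ i * (\<Sum>j\<in>UNIV. mu $ j * D i j))"
    by (simp add: sum_distrib_left mult.assoc)
  also have "\<dots> = (\<Sum>i\<in>UNIV. lam $ i * mu $ i)" using 1 2 by linarith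
  finally have tr: "(\<Sum>i\<in>UNIV. \<Sum>j\<in>UNIV. lam $ i * mu $ j * D i j) = (\<Sum>i\<in>UNIV. lam $ i * mu $ i)" .
  have "(\<Sum>j\<in>UNIV. D i j) = 1" for i
    by (simp add: D_def onb_norm_square[OF w(1), symmetric] onb_norm_1[OF u(1)])
  moreover have "(\<Sum>i\<in>UNIV. D i j) = 1" for j
    by (simp add: D_def cmod_cinner_commute[of _ "w j"] onb_norm_square[OF u(1), symmetric] onb_norm_1[OF w(1)])
  ultimately have supp: "\<exists>m. lam $ m = lam $ i \<and> mu $ m = mu $ j" if "cinner (u i) (w j) \<noteq> 0" for i j
    using that by (intro rearrangement_equality_support[of lam mu D] lam_dec mu_inc tr) (simp_all add: D_def)
  have chain: "mu $ k \<le> mu $ l" if "lam $ k > lam $ l" for k l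
    using that lam_dec[of l k] by (intro mu_inc) (metis linorder_le_cases not_le)
  have Buu: "cinner (B *v u i) (u k) = 0" if ne: "lam $ i \<noteq> lam $ k" for i k
  proof -
    define t where "t j = cinner (u i) (w j) * cinner (w j) (u k)" for j
    have "cinner (B *v u i) (w j) = of_real (mu $ j) * cinner (u i) (w j)" for j
      by (simp add: hermitianD[OF B] w(2) cinner_scaleR_right)
    then have Bt: "cinner (B *v u i) (u k) = (\<Sum>j\<in>UNIV. of_real (mu $ j) * t j)"
      by (simp add: onb_parseval[OF w(1), of "B *v u i" "u k"] t_def mult.assoc)
    have const: "mu $ j = mu $ j'" if "t j \<noteq> 0" "t j' \<noteq> 0" for j j'
    proof -
      have "cinner (u i) (w j) \<noteq> 0" "cinner (u k) (w j) \<noteq> 0"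
           "cinner (u i) (w j') \<noteq> 0" "cinner (u k) (w j') \<noteq> 0"
        using that by (auto simp: t_def cinner_commute[of "w j"] cinner_commute[of "w j'"])
      from this[THEN supp] obtain m1 m2 m3 m4 where
        "lam $ m1 = lam $ i \<and> mu $ m1 = mu $ j" "lam $ m2 = lam $ k \<and> mu $ m2 = mu $ j"
        "lam $ m3 = lam $ i \<and> mu $ m3 = mu $ j'" "lam $ m4 = lam $ k \<and> mu $ m4 = mu $ j'"
        by blast
      with ne chain[of m1 m4] chain[of m4 m1] chain[of m3 m2] chain[of m2 m3] show ?thesis
        by (cases "lam $ i < lam $ k") auto
    qed
    have "\<exists>b. \<forall>j. of_real (mu $ j) * t j = b * t j"
    proof (cases "\<exists>j. t j \<noteq> 0")
      case True
      then show ?thesis using const by (metis mult_zero_right)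
    qed auto
    then obtain b where bt: "\<And>j. of_real (mu $ j) * t j = b * t j" by blast
    have "cinner (B *v u i) (u k) = b * (\<Sum>j\<in>UNIV. t j)"
      by (simp only: Bt bt sum_distrib_left)
    also have "(\<Sum>j\<in>UNIV. t j) = cinner (u i) (u k)"
      by (simp add: t_def onb_parseval[OF w(1), of "u i" "u k"])
    finally show ?thesis using ne by (auto simp: onb_cinner[OF u(1)])
  qed
  have "A *v (B *v u i) = B *v (A *v u i)" for i
  proof (rule onb_eqI[OF u(1)])
    fix k
    show "cinner (A *v (B *v u i)) (u k) = cinner (B *v (A *v u i)) (u k)"
      using Buu[of i k]
      by (cases "lam $ i = lam $ k")
        (simp_all add: hermitianD[OF A] u(2) cinner_scaleR_left cinner_scaleR_right matrix_vector_mult_scaleR)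
  qed
  then have "A ** B = B ** A"
    by (intro onb_matrix_eqI[OF u(1)]) (simp add: matrix_vector_mul_assoc[symmetric])
  then have "A *v (B *v x) = B *v (A *v x)" for x
    by (simp add: matrix_vector_mul_assoc)
  then obtain v a b where v: "onb v" "\<And>i. A *v v i = a i *\<^sub>R v i" "\<And>i. B *v v i = b i *\<^sub>R v i"
    using commuting_hermitian_joint_eigenbasis[OF A B] by blast
  \<comment> \<open>Expanding \<open>v k\<close> in both bases, some pair \<open>u i\<close>, \<open>w j\<close> with nonzero overlap has the eigenvalues of \<open>v k\<close>.\<close>
  have R: "\<exists>m. lam $ m = a k \<and> mu $ m = b k" for k
  proof -
    have "cinner (v k) (v k) \<noteq> 0" by (simp add: onb_cinner[OF v(1)])
    then obtain i where i: "cinner (u i) (v k) \<noteq> 0"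
      using onb_common_overlap[OF u(1)] by blast
    then obtain j where j: "cinner (u i) (w j) \<noteq> 0" "cinner (w j) (v k) \<noteq> 0"
      using onb_common_overlap[OF w(1)] by blast
    have "lam $ i = a k" by (rule hermitian_eigenvectors_orthogonal[OF A u(2) v(2) i])
    moreover have "mu $ j = b k" by (rule hermitian_eigenvectors_orthogonal[OF B w(2) v(3) j(2)])
    ultimately show ?thesis using supp[OF j(1)] by simp
  qed
  have chain': "b k \<le> b l" if "a k > a l" for k l
    using R[of k] R[of l] chain that by metis
  \<comment> \<open>Along the chain, \<open>b - a\<close> grows exactly as \<open>a\<close> falls and \<open>b\<close> grows, so one key sorts both.\<close>
  obtain \<pi> :: "'d \<Rightarrow> 'd" where \<pi>: "bij \<pi>" "\<And>i j. i \<le> j \<Longrightarrow> b (\<pi> i) - a (\<pi> i) \<le> b (\<pi> j) - a (\<pi> j)"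
    using exists_bij_sorting[of "\<lambda>i. b i - a i"] by blast
  have a_dec: "a (\<pi> j) \<le> a (\<pi> i)" and b_inc: "b (\<pi> i) \<le> b (\<pi> j)" if "i \<le> j" for i j
    using \<pi>(2)[OF that] chain'[of "\<pi> i" "\<pi> j"] chain'[of "\<pi> j" "\<pi> i"] by linarith+
  define a' where "a' = (\<chi> i. a (\<pi> i))"
  define b' where "b' = (\<chi> i. b (\<pi> i))"
  have v': "onb (\<lambda>i. v (\<pi> i))" by (rule onb_permute[OF v(1) \<pi>(1)])
  have av: "A *v v (\<pi> i) = (a' $ i) *\<^sub>R v (\<pi> i)" and bv: "B *v v (\<pi> i) = (b' $ i) *\<^sub>R v (\<pi> i)" for i
    by (simp_all add: a'_def b'_def v)
  have "lam = a'"
    unfolding lam_def eigvals_eq[OF v' av] using a_dec by (intro dec_vec_eqI) (auto simp: a'_def)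
  moreover have "mu = b'"
    unfolding mu_def eigvals_inc_def eigvals_eq[OF v' bv] inc_vec_dec_vec
    using b_inc by (intro inc_vec_eqI) (auto simp: b'_def)
  ultimately show ?thesis
    using v' av bv by (intro exI[of _ "\<lambda>i. v (\<pi> i)"]) (simp add: lam_def mu_def)
qed

section \<open>Completions with optimal spectra\<close>

lemma norms_of_completion:
  assumes "F0 @ G \<in> completions a F0"
  shows "map (\<lambda>g. (norm g)\<^sup>2) G = a"
  using assms by (auto simp: completions_def intro: nth_equalityI)

lemma eigvals_inc_in_Gamma_set:
  assumes "F0 @ G \<in> completions a F0"
  shows "eigvals_inc (frame_op G) \<in> Gamma_set a"
proof -
  obtain v where v: "onb v" "\<And>i. frame_op G *v v i = (eigvals_inc (frame_op G) $ i) *\<^sub>R v i"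
    using hermitian_eigenbasis_inc[OF hermitian_frame_op] by blast
  have "eigvals_inc (frame_op G) = inc_vec (eigvals_inc (frame_op G))"
    unfolding inc_vec_fixed_iff by (simp add: eigvals_inc_def inc_vec_mono)
  with frame_norms_majorized[OF v] frame_norms_substochastic(1)[OF v] norms_of_completion[OF assms]
  show ?thesis by (simp add: Gamma_set_def)
qed

text \<open>
  The new vectors are chosen with a frame operator that is diagonal in an eigenbasis of the given
  one, with the increasing \<open>\<mu>\<close> against the decreasing spectrum.
\<close>

lemma exists_op_completion:
  fixes F0 :: "(complex, 'd::{finite,linorder}) vec list"
  assumes \<mu>: "\<mu> \<in> Gamma_set a"
  shows "\<exists>F\<in>op_completions a F0. eigvals (frame_op F) = dec_vec (eigvals (frame_op F0) + \<mu>)"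
proof -
  obtain v where v: "onb v" "\<And>i. frame_op F0 *v v i = (eigvals (frame_op F0) $ i) *\<^sub>R v i"
    using hermitian_eigenbasis[OF hermitian_frame_op] by blast
  have pos: "\<And>i. 0 \<le> \<mu> $ i" and inc: "inc_vec \<mu> = \<mu>" and maj: "a \<prec>\<^sub>m vec_list \<mu>"
    using \<mu> by (auto simp: Gamma_set_def)
  obtain G where G: "map (\<lambda>g. (norm g)\<^sup>2) G = a"
      "frame_op G = (\<Sum>i\<in>UNIV. (\<mu> $ i) *\<^sub>R rank_one (v i) (v i))"
    using frame_with_majorized_norms[OF maj pos v(1)] by blast
  have SG: "frame_op G *v v i = (\<mu> $ i) *\<^sub>R v i" for i
    unfolding G(2) by (rule spectral_sum_mult[OF v(1)])
  have eG: "eigvals_inc (frame_op G) = \<mu>"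
    by (simp add: eigvals_inc_def eigvals_eq[OF v(1) SG] inc_vec_dec_vec inc)
  have "frame_op (F0 @ G) *v v i = ((eigvals (frame_op F0) + \<mu>) $ i) *\<^sub>R v i" for i
    by (simp add: matrix_vector_mult_add_rdistrib v(2) SG scaleR_add_left)
  then have "eigvals (frame_op (F0 @ G)) = dec_vec (eigvals (frame_op F0) + \<mu>)"
    by (rule eigvals_eq[OF v(1)])
  moreover have "F0 @ G \<in> completions a F0"
    using G(1) by (auto simp: completions_def)
  ultimately show ?thesis
    by (intro bexI[of _ "F0 @ G"]) (auto simp: op_completions_def eG)
qed

theorem theorem3p3:
  fixes F0 :: "(complex ^ 'd::{finite,linorder}) list"
    and a :: "real list"
    and lam :: "real ^ 'd::{finite,linorder}"
  assumes "initial_data F0 a"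
    and "lam = eigvals (frame_op F0)"
  shows "(compact (Lambda_op a lam) \<and> convex (Lambda_op a lam)) \<and>
    {eigvals (frame_op F) | F. F \<in> op_completions a F0} = {dec_vec \<nu> | \<nu>. \<nu> \<in> Lambda_op a lam} \<and>
    (\<forall>G \<mu>. F0 @ G \<in> op_completions a F0 \<and> eigvals_inc (frame_op G) = \<mu> \<longrightarrow>
      (\<exists>v. onb v \<and> (\<forall>i. frame_op F0 *v v i = (lam $ i) *\<^sub>R v i) \<and>
         frame_op G = (\<Sum>i\<in>UNIV. (\<mu> $ i) *\<^sub>R rank_one (v i) (v i)) \<and>
         frame_op (F0 @ G) = frame_op F0 + frame_op G \<and>
         frame_op F0 + frame_op G = (\<Sum>i\<in>UNIV. (lam $ i + \<mu> $ i) *\<^sub>R rank_one (v i) (v i))))"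
proof (intro conjI allI impI)
  show "compact (Lambda_op a lam)" "convex (Lambda_op a lam)"
    using compact_convex_Lambda_op by blast+
next
  have lam: "dec_vec lam = lam"
    by (simp add: assms(2) dec_vec_eigvals hermitian_frame_op)
  show "{eigvals (frame_op F) | F. F \<in> op_completions a F0} = {dec_vec \<nu> | \<nu>. \<nu> \<in> Lambda_op a lam}"
  proof (intro equalityI subsetI)
    fix x assume "x \<in> {eigvals (frame_op F) | F. F \<in> op_completions a F0}"
    then obtain G where G: "F0 @ G \<in> completions a F0"
        "x = dec_vec (lam + eigvals_inc (frame_op G))"
      by (auto simp: op_completions_def assms(2))
    then show "x \<in> {dec_vec \<nu> | \<nu>. \<nu> \<in> Lambda_op a lam}"
      using eigvals_inc_in_Gamma_set[OF G(1)] by (auto simp: Lambda_op_def lam)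
  next
    fix x assume "x \<in> {dec_vec \<nu> | \<nu>. \<nu> \<in> Lambda_op a lam}"
    then obtain \<mu> where "\<mu> \<in> Gamma_set a" "x = dec_vec (lam + \<mu>)"
      by (auto simp: Lambda_op_def lam)
    then obtain F where "F \<in> op_completions a F0" "x = eigvals (frame_op F)"
      using exists_op_completion[of \<mu> a F0] by (metis assms(2))
    then show "x \<in> {eigvals (frame_op F) | F. F \<in> op_completions a F0}" by blast
  qed
next
  fix G \<mu>
  assume "F0 @ G \<in> op_completions a F0 \<and> eigvals_inc (frame_op G) = \<mu>"
  then have "eigvals (frame_op F0 + frame_op G) = dec_vec (eigvals (frame_op F0) + eigvals_inc (frame_op G))"
    and \<mu>: "eigvals_inc (frame_op G) = \<mu>"
    by (auto simp: op_completions_def)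
  then obtain v where v: "onb v" "\<And>i. frame_op F0 *v v i = (lam $ i) *\<^sub>R v i"
      "\<And>i. frame_op G *v v i = (\<mu> $ i) *\<^sub>R v i"
    using lidskii_equality_joint_eigenbasis[OF hermitian_frame_op hermitian_frame_op, of F0 G]
    by (auto simp: assms(2))
  have "(frame_op F0 + frame_op G) *v v i = (lam $ i + \<mu> $ i) *\<^sub>R v i" for i
    by (simp add: matrix_vector_mult_add_rdistrib v scaleR_add_left)
  from spectral_sum_eq[OF v(1) this] spectral_sum_eq[OF v(1,3)] v(1,2)
  show "\<exists>v. onb v \<and> (\<forall>i. frame_op F0 *v v i = (lam $ i) *\<^sub>R v i) \<and>
         frame_op G = (\<Sum>i\<in>UNIV. (\<mu> $ i) *\<^sub>R rank_one (v i) (v i)) \<and>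
         frame_op (F0 @ G) = frame_op F0 + frame_op G \<and>
         frame_op F0 + frame_op G = (\<Sum>i\<in>UNIV. (lam $ i + \<mu> $ i) *\<^sub>R rank_one (v i) (v i))"
    by (intro exI[of _ v] conjI allI frame_op_append)
qed

end
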